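(* Let $n\geq 4$ be an even integer and let $u\in C^\infty(\mathbb{R}^n)$ be radially symmetric (about the origin). Consider the conformal metric $g=e^{2u}|dx|^2$ on $\mathbb{R}^n$ and assume that it has finite total Q-curvature, i.e. $Q_g e^{nu}\in L^1(\mathbb{R}^n)$. Suppose that $Q_g\geq (n-1)!$ on $\mathbb{R}^n$ and that the scalar curvature satisfies $R_g\geq 0$ near infinity (i.e. outside some compact set). Then $$\int_{\mathbb{R}^n}e^{nu}\,dx\leq |\mathbb{S}^n|,$$ with equality if and only if $u(x)=\log\frac{2\lambda}{\lambda^2+|x|^2}$ for some constant $\lambda>0$.
   Context: For $g=e^{2u}|dx|^2$ on $\mathbb{R}^n$ with $n$ even and $u$ smooth, the Q-curvature $Q_g$ is the function defined by $(-\Delta)^{n/2}u=Q_g e^{nu}$ on $\mathbb{R}^n$, and the scalar curvature is $R_g=2(n-1)e^{-2u}\left(-\Delta u-\frac{n-2}{2}|\nabla u|^2\right)$, where $\Delta$ is the Euclidean Laplacian. $|\mathbb{S}^n|$ denotes the volume of the standard unit $n$-sphere. *)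

theory Defs
  imports "HOL-Analysis.Analysis"
begin

definition partial_deriv :: "'n::finite \<Rightarrow> (real ^ 'n \<Rightarrow> real) \<Rightarrow> real ^ 'n \<Rightarrow> real" where
  "partial_deriv i f x = frechet_derivative f (at x) (axis i 1)"

primrec C_k :: "nat \<Rightarrow> (real ^ 'n::finite \<Rightarrow> real) \<Rightarrow> bool" where
  "C_k 0 f \<longleftrightarrow> continuous_on UNIV f"
| "C_k (Suc k) f \<longleftrightarrow> (\<forall>x. f differentiable (at x)) \<and> (\<forall>i. C_k k (partial_deriv i f))"

definition smooth :: "(real ^ 'n::finite \<Rightarrow> real) \<Rightarrow> bool" where
  "smooth f \<longleftrightarrow> (\<forall>k. C_k k f)"

definition radially_symmetric :: "(real ^ 'n::finite \<Rightarrow> real) \<Rightarrow> bool" where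
  "radially_symmetric f \<longleftrightarrow> (\<forall>x y. norm x = norm y \<longrightarrow> f x = f y)"

definition grad :: "(real ^ 'n::finite \<Rightarrow> real) \<Rightarrow> real ^ 'n \<Rightarrow> real ^ 'n" where
  "grad f x = (\<chi> i. partial_deriv i f x)"

definition laplacian :: "(real ^ 'n::finite \<Rightarrow> real) \<Rightarrow> real ^ 'n \<Rightarrow> real" where
  "laplacian f x = (\<Sum>i\<in>UNIV. partial_deriv i (partial_deriv i f) x)"

definition neg_laplacian :: "(real ^ 'n::finite \<Rightarrow> real) \<Rightarrow> real ^ 'n \<Rightarrow> real" where
  "neg_laplacian f x = - laplacian f x"

(* Both curvatures are those of the conformal metric exp(2u)|dx|^2 and take the conformal
   factor u as argument. Q_curvature is the solution Q of (-Delta)^(n/2) u = Q exp(n u),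
   meaningful for even n = CARD('n). *)

definition Q_curvature :: "(real ^ 'n::finite \<Rightarrow> real) \<Rightarrow> real ^ 'n \<Rightarrow> real" where
  "Q_curvature u x =
     (neg_laplacian ^^ (CARD('n) div 2)) u x / exp (real CARD('n) * u x)"

definition scalar_curvature :: "(real ^ 'n::finite \<Rightarrow> real) \<Rightarrow> real ^ 'n \<Rightarrow> real" where
  "scalar_curvature u x =
     2 * (real CARD('n) - 1) * exp (- 2 * u x) *
       (- laplacian u x - (real CARD('n) - 2) / 2 * (norm (grad u x))\<^sup>2)"

lemma Q_curvature_eq:
  fixes u :: "real ^ 'n::finite \<Rightarrow> real"
  shows "(neg_laplacian ^^ (CARD('n) div 2)) u x = Q_curvature u x * exp (real CARD('n) * u x)"
  by (simp add: Q_curvature_def)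

(* Surface measure of a subset E of the unit sphere of R^m, normalised by polar coordinates
   (dx = r^(m-1) dr dS): m times the Lebesgue measure of the cone over E with apex 0. *)

definition sphere_measure :: "(real ^ 'm::finite) set \<Rightarrow> real" where
  "sphere_measure E =
     real CARD('m) * measure lebesgue {r *\<^sub>R x | r x. 0 < r \<and> r \<le> 1 \<and> x \<in> E}"

(* |S^n| for n = CARD('n); the index type 'n option has n + 1 elements, so the sphere below is
   the unit sphere of R^(n+1). *)

definition sphere_volume :: "'n::finite itself \<Rightarrow> real" where
  "sphere_volume _ = sphere_measure (sphere 0 1 :: (real ^ 'n option) set)"

lemma sphere_volume_eq:
  "sphere_volume TYPE('n::finite) =
     2 * pi powr ((real CARD('n) + 1) / 2) / Gamma ((real CARD('n) + 1) / 2)"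
proof -
  let ?V = "UNIV :: (real ^ 'n option) set"
  have cone: "{r *\<^sub>R x | r x. 0 < r \<and> r \<le> 1 \<and> x \<in> sphere 0 1} = cball 0 1 - {0 :: real ^ 'n option}"
    (is "?C = ?B")
  proof (intro set_eqI iffI)
    fix y assume "y \<in> ?B"
    then have "y = norm y *\<^sub>R (y /\<^sub>R norm y) \<and> 0 < norm y \<and> norm y \<le> 1 \<and> y /\<^sub>R norm y \<in> sphere 0 1"
      by simp
    then show "y \<in> ?C" by blast
  qed auto
  have "measure lebesgue ?B = measure lebesgue (cball (0 :: real ^ 'n option) 1)"
    by (intro measure_Diff_null_set) auto
  also have "\<dots> = unit_ball_vol (real CARD('n) + 1)"
    by (simp add: content_cball add.commute)
  finally have "sphere_volume TYPE('n) = (real CARD('n) + 1) * unit_ball_vol (real CARD('n) + 1)"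
    by (simp only: sphere_volume_def sphere_measure_def cone) (simp add: add.commute)
  moreover have "Gamma ((real CARD('n) + 1) / 2 + 1) = (real CARD('n) + 1) / 2 * Gamma ((real CARD('n) + 1) / 2)"
    by (rule Gamma_plus1) (auto dest: nonpos_Ints_nonpos)
  moreover have "real CARD('n) + 1 \<noteq> 0" by linarith
  ultimately show ?thesis
    by (simp add: unit_ball_vol_def)
qed

end

theory Submission
  imports Defs
begin

text \<open>
  Put t = ln r, D = d/dt, n = 2 m, v(t) = u(r) and p = - D v. The radial equation becomes D P = F, where
  P = L p, the operator L is the product of (2 j - D) (2 j + D) over 0 < j < m, and F = exp (n t) (-Delta)^m u.
  Positivity of the scalar curvature is the Riccati inequality D p \<ge> (m - 1) p (p - 2), which near
  infinity rules out p \<rightarrow> \<plusminus>\<infinity>. Solving the first-order factors of L one at a time,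
  each intermediate function is then bounded, so p tends to P(\<infinity>) / L(0), and the Riccati inequality forces
  this limit to be at most 2. Hence the total Q-curvature is at most that of the sphere, and Q \<ge> (n-1)!
  turns this into the volume bound.

  In the equality case Q = (n-1)!, and both U = t + v and the round profile U = - ln cosh t satisfy
  D U = 1 - p, D P = (n-1)! exp (n U), with the same limits of P at both ends. Slide the round P to the left
  until it lies above the given P, and then back to the extremal position. Since the bounded
  inverse of L is strictly positive, the difference of the two U would then be strictly
  increasing unless the solutions agree, and this either contradicts the contact of the two P, or leaves room to slide further.
\<close>

section \<open>Constant-coefficient operators on the line\<close>

text \<open>The kernel of L contains exp (2 j t) = r^(2 j) for 0 < j < m, which is smooth at the
  origin, so the equation alone does not tie p to P. Boundedness of p could not be passed through
  the factors directly, since it says nothing about derivatives of p. What can be passed on is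
  definite divergence to \<plusminus>\<infinity>: if (a \<plusminus> D) y diverges, so does y.
  Non-divergence therefore descends from p to every intermediate function, and boundedness climbs
  back from P to p.

  The number 2 is an equilibrium of the Riccati equation. The round metric has p = 1 + tanh t,
  running from 0 to 2, so its P runs from 0 to 2 L(0). P(\<infinity>) is the total Q-curvature
  divided by n times the volume of the unit ball.

  For rigidity, an equation of high order has no second-order maximum principle for U. The
  substitute is that the bounded inverse of each a \<plusminus> D preserves order, and this acts on
  P. Equality forces P(\<infinity>) = 2 L(0), so two functions P can be compared by integrating from
  either end.\<close>

text \<open>Bounds are required only towards -\<infinity>, where they reflect smoothness at r = 0;
  the behaviour at +\<infinity> is what the curvature hypotheses have to supply. All derivatives are
  included so that the class is closed under D.\<close>

definition tame :: "(real \<Rightarrow> real) \<Rightarrow> bool" where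
  "tame y \<longleftrightarrow> (\<forall>i t. (deriv ^^ i) y differentiable (at t)) \<and> (\<forall>i T. bounded ((deriv ^^ i) y ` {..T}))"

lemma tame_DERIV: "tame y \<Longrightarrow> (y has_real_derivative deriv y t) (at t)"
  unfolding tame_def using DERIV_deriv_iff_real_differentiable
  by (metis funpow_0)

lemma tame_bounded: "tame y \<Longrightarrow> bounded (y ` {..T})"
  unfolding tame_def by (metis funpow_0)

lemma tame_deriv: "tame y \<Longrightarrow> tame (deriv y)"
  unfolding tame_def by (metis funpow_Suc_right o_apply)

lemma tame_continuous: "tame y \<Longrightarrow> continuous_on S y"
  by (meson tame_DERIV DERIV_continuous_on has_field_derivative_at_within)

lemma deriv_eqI: "(\<And>t. (y has_real_derivative y' t) (at t)) \<Longrightarrow> deriv y = y'"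
  by (auto intro!: ext DERIV_imp_deriv)

text \<open>\<open>\<Phi>\<close> is an invariant in the sense of coinduction: it only has to be
  closed under D and to imply bounds on left half-lines, so no formula for the i-th derivative is
  needed.\<close>

lemma tame_coinduct:
  assumes "\<Phi> y"
    and step: "\<And>y. \<Phi> y \<Longrightarrow> \<exists>y'. \<Phi> y' \<and> (\<forall>t. (y has_real_derivative y' t) (at t)) \<and> (\<forall>T. bounded (y ` {..T}))"
  shows "tame y"
proof -
  have "\<Phi> ((deriv ^^ i) y)" for i
  proof (induction i)
    case (Suc i)
    then show ?case using step[OF Suc] deriv_eqI by auto
  qed (use assms in simp)
  then show ?thesis
    unfolding tame_def using step real_differentiable_def by blast
qed

lemma bounded_image_atMost:
  fixes y :: "real \<Rightarrow> real"
  assumes "\<And>S. continuous_on S y" and "(y \<longlongrightarrow> l) at_bot"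
  shows "bounded (y ` {..T})"
proof -
  from assms(2) have "eventually (\<lambda>t. dist (y t) l < 1) at_bot" by (rule tendstoD) simp
  then obtain N where N: "\<And>t. t \<le> N \<Longrightarrow> dist (y t) l < 1" by (auto simp: eventually_at_bot_linorder)
  have "y t \<in> ball l 1 \<union> y ` {N..T}" if "t \<le> T" for t
    using N[of t] that by (cases "t \<le> N") (auto simp: dist_commute)
  then have "y ` {..T} \<subseteq> ball l 1 \<union> y ` {N..T}" by blast
  moreover have "bounded (y ` {N..T})"
    by (intro compact_imp_bounded compact_continuous_image assms compact_Icc)
  ultimately show ?thesis by (meson bounded_Un bounded_ball bounded_subset)
qed

lemma bounded_image_lincomb:
  fixes y z :: "'a \<Rightarrow> real"
  assumes "bounded (y ` S)" "bounded (z ` S)"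
  shows "bounded ((\<lambda>t. a * y t + b * z t) ` S)"
  using bounded_plus_comp[of "\<lambda>t. a * y t" S "\<lambda>t. b * z t"]
    bounded_scaling[OF assms(1), of a] bounded_scaling[OF assms(2), of b]
  by (simp add: image_image)

lemma tame_lincomb:
  assumes "tame y" "tame z"
  shows "tame (\<lambda>t. a * y t + b * z t)"
proof (rule tame_coinduct[where \<Phi> = "\<lambda>w. \<exists>y z. tame y \<and> tame z \<and> w = (\<lambda>t. a * y t + b * z t)"])
  fix w assume "\<exists>y z. tame y \<and> tame z \<and> w = (\<lambda>t. a * y t + b * z t)"
  then obtain y z where w: "tame y" "tame z" "w = (\<lambda>t. a * y t + b * z t)" by blast
  have "bounded (w ` {..T})" for T
    unfolding w(3) by (intro bounded_image_lincomb tame_bounded w)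
  moreover have "(w has_real_derivative a * deriv y t + b * deriv z t) (at t)" for t
    unfolding w(3) using tame_DERIV[OF w(1), of t] tame_DERIV[OF w(2), of t]
    by (auto intro!: derivative_eq_intros)
  ultimately show "\<exists>w'. (\<exists>y z. tame y \<and> tame z \<and> w' = (\<lambda>t. a * y t + b * z t)) \<and>
      (\<forall>t. (w has_real_derivative w' t) (at t)) \<and> (\<forall>T. bounded (w ` {..T}))"
    using tame_deriv[OF w(1)] tame_deriv[OF w(2)]
    by (intro exI[of _ "\<lambda>t. a * deriv y t + b * deriv z t"]) auto
qed (use assms in blast)

lemma tame_const: "tame (\<lambda>t. a)"
  by (rule tame_coinduct[where \<Phi> = "\<lambda>y. \<exists>a. y = (\<lambda>t. a)"]) (auto intro!: exI[of _ "\<lambda>t. 0"] simp: bounded_iff)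

lemma tame_shift:
  assumes "tame y"
  shows "tame (\<lambda>t. y (t + l))"
proof (rule tame_coinduct[where \<Phi> = "\<lambda>w. \<exists>y. tame y \<and> w = (\<lambda>t. y (t + l))"])
  fix w assume "\<exists>y. tame y \<and> w = (\<lambda>t. y (t + l))"
  then obtain y where w: "tame y" "w = (\<lambda>t. y (t + l))" by blast
  have "w ` {..T} \<subseteq> y ` {..T + l}" for T using w(2) by auto
  then have "bounded (w ` {..T})" for T using tame_bounded[OF w(1)] bounded_subset by blast
  moreover have "(w has_real_derivative deriv y (t + l)) (at t)" for t
    unfolding w(2) using tame_DERIV[OF w(1), of "t + l"]
    by (simp add: DERIV_shift)
  ultimately show "\<exists>w'. (\<exists>y. tame y \<and> w' = (\<lambda>t. y (t + l))) \<and>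
      (\<forall>t. (w has_real_derivative w' t) (at t)) \<and> (\<forall>T. bounded (w ` {..T}))"
    using tame_deriv[OF w(1)] by (intro exI[of _ "\<lambda>t. deriv y (t + l)"]) auto
qed (use assms in blast)

section \<open>Polynomials in D as operators\<close>

definition dop :: "real poly \<Rightarrow> (real \<Rightarrow> real) \<Rightarrow> real \<Rightarrow> real" where
  "dop q y t = (\<Sum>i\<le>degree q. coeff q i * (deriv ^^ i) y t)"

lemma dop_altdef:
  assumes "degree q \<le> N"
  shows "dop q y t = (\<Sum>i\<le>N. coeff q i * (deriv ^^ i) y t)"
  unfolding dop_def using assms
  by (intro sum.mono_neutral_left) (auto simp: coeff_eq_0)

text \<open>Horner recursion for the symbol; the inductions on \<open>q\<close> below run on
  it.\<close>

lemma dop_pCons: "dop (pCons a q) y t = a * y t + dop q (deriv y) t"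
proof -
  have "dop (pCons a q) y t = (\<Sum>i\<le>Suc (degree q). coeff (pCons a q) i * (deriv ^^ i) y t)"
    by (rule dop_altdef) (simp add: degree_pCons_le)
  also have "\<dots> = a * y t + (\<Sum>i\<le>degree q. coeff q i * (deriv ^^ Suc i) y t)"
    by (subst sum.atMost_Suc_shift) simp
  finally show ?thesis by (simp add: dop_def funpow_swap1)
qed

lemma dop_0 [simp]: "dop 0 y = (\<lambda>t. 0)"
  by (simp add: dop_def fun_eq_iff)

lemma dop_1 [simp]: "dop 1 y = y"
  by (rule ext) (simp add: dop_def)

lemma dop_add: "dop (q + r) y t = dop q y t + dop r y t"
proof -
  let ?N = "max (degree q) (degree r)"
  show ?thesis
    using dop_altdef[of q ?N y t] dop_altdef[of r ?N y t] dop_altdef[of "q + r" ?N y t]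
    by (simp add: degree_add_le sum.distrib algebra_simps)
qed

lemma dop_smult: "dop (smult a q) y t = a * dop q y t"
  using dop_altdef[of "smult a q" "degree q" y t] 
  by (simp add: dop_def sum_distrib_left mult.assoc)

lemma deriv_lincomb:
  assumes "tame y" "tame z"
  shows "deriv (\<lambda>t. a * y t + b * z t) = (\<lambda>t. a * deriv y t + b * deriv z t)"
  using tame_DERIV[OF assms(1)] tame_DERIV[OF assms(2)]
  by (intro deriv_eqI) (auto intro!: derivative_eq_intros)

lemma dop_lincomb:
  "tame y \<Longrightarrow> tame z \<Longrightarrow> dop q (\<lambda>t. a * y t + b * z t) t = a * dop q y t + b * dop q z t"
proof (induction q arbitrary: y z)
  case (pCons c q)
  then show ?case
    by (simp add: dop_pCons deriv_lincomb tame_deriv algebra_simps)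
qed simp

lemma deriv_shift:
  assumes "tame y"
  shows "deriv (\<lambda>t. y (t + l)) = (\<lambda>t. deriv y (t + l))"
  using tame_DERIV[OF assms] by (intro deriv_eqI) (simp flip: DERIV_shift)

lemma dop_shift: "tame y \<Longrightarrow> dop q (\<lambda>t. y (t + l)) t = dop q y (t + l)"
proof (induction q arbitrary: y)
  case (pCons c q)
  then show ?case by (simp add: dop_pCons deriv_shift tame_deriv)
qed simp

lemma dop_const: "dop q (\<lambda>t. a) t = coeff q 0 * a"
proof (induction q arbitrary: a)
  case (pCons c q)
  then show ?case using pCons(2)[of 0] by (simp add: dop_pCons)
qed simp

lemma tame_dop: "tame y \<Longrightarrow> tame (dop q y)"
proof (induction q arbitrary: y)
  case (pCons c q)
  have "dop (pCons c q) y = (\<lambda>t. c * y t + 1 * dop q (deriv y) t)"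
    by (simp add: dop_pCons fun_eq_iff)
  then show ?case by (simp only: tame_lincomb[OF pCons(3) pCons(2)[OF tame_deriv[OF pCons(3)]]])
qed (simp add: tame_const)

lemma deriv_dop: "tame y \<Longrightarrow> deriv (dop q y) = dop q (deriv y)"
proof (induction q arbitrary: y)
  case (pCons c q)
  have "dop (pCons c q) y = (\<lambda>t. c * y t + 1 * dop q (deriv y) t)"
    by (simp add: dop_pCons fun_eq_iff)
  then have "deriv (dop (pCons c q) y) = (\<lambda>t. c * deriv y t + 1 * deriv (dop q (deriv y)) t)"
    by (simp only: deriv_lincomb[OF pCons(3) tame_dop[OF tame_deriv[OF pCons(3)]]])
  also have "\<dots> = dop (pCons c q) (deriv y)"
    by (simp add: pCons tame_deriv dop_pCons fun_eq_iff)
  finally show ?case .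
qed (simp add: fun_eq_iff)

text \<open>Commutativity of polynomials thereby becomes commutativity of operators, which later
  allows factors to be split off in any order.\<close>

lemma dop_mult: "tame y \<Longrightarrow> dop (q * r) y t = dop q (dop r y) t"
proof (induction q arbitrary: y t)
  case (pCons c q)
  then show ?case
    by (simp add: dop_add dop_smult dop_pCons deriv_dop tame_deriv)
qed simp

section \<open>Products of first-order factors\<close>

definition diverges :: "(real \<Rightarrow> real) \<Rightarrow> bool" where
  "diverges y \<longleftrightarrow> filterlim y at_top at_top \<or> filterlim y at_bot at_top"

text \<open>Integrating factor: the derivative of exp (k t) (y - d) is exp (k t) (k (y - d) +
  y').\<close>

lemma exp_weight_mono:
  fixes y :: "real \<Rightarrow> real"
  assumes der: "\<And>t. (y has_real_derivative y' t) (at t)"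
    and "s \<le> t" and ge: "\<And>x. s \<le> x \<Longrightarrow> x \<le> t \<Longrightarrow> k * (y x - d) + y' x \<ge> 0"
  shows "exp (k * s) * (y s - d) \<le> exp (k * t) * (y t - d)"
proof (rule DERIV_nonneg_imp_nondecreasing[OF \<open>s \<le> t\<close>])
  fix x assume x: "s \<le> x" "x \<le> t"
  have "((\<lambda>t. exp (k * t) * (y t - d)) has_real_derivative exp (k * x) * (k * (y x - d) + y' x)) (at x)"
    by (auto intro!: derivative_eq_intros der simp: algebra_simps)
  then show "\<exists>z. ((\<lambda>t. exp (k * t) * (y t - d)) has_real_derivative z) (at x) \<and> 0 \<le> z"
    using ge[OF x] by (intro exI[of _ "exp (k * x) * (k * (y x - d) + y' x)"]) auto
qed

text \<open>The reference level is b / a. For s = 1 a deficit below it decays like exp (- a t),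
  which gives the first alternative. For s = -1 a deficit, once present, grows like exp (a t) and
  drives y to -\<infinity>.\<close>

lemma eventually_ge_or_at_bot:
  fixes y :: "real \<Rightarrow> real"
  assumes der: "\<And>t. (y has_real_derivative y' t) (at t)"
    and a: "a > 0" and s: "s = 1 \<or> s = -1"
    and ev: "eventually (\<lambda>t. a * y t + s * y' t \<ge> b) at_top" and b': "b' < b / a"
  shows "eventually (\<lambda>t. y t \<ge> b') at_top \<or> filterlim y at_bot at_top"
proof -
  from ev obtain N where N: "\<And>t. t \<ge> N \<Longrightarrow> a * y t + s * y' t \<ge> b" by (auto simp: eventually_at_top_linorder)
  show ?thesis
  proof (cases "s = 1")
    case True
    have "y t \<ge> b / a + exp (a * (N - t)) * (y N - b / a)" if "t \<ge> N" for t
    proof -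
      have "exp (a * N) * (y N - b / a) \<le> exp (a * t) * (y t - b / a)"
      proof (rule exp_weight_mono[OF der that])
        fix x assume "N \<le> x"
        then show "0 \<le> a * (y x - b / a) + y' x"
          using N[of x] a True by (simp add: right_diff_distrib)
      qed
      moreover have "exp (a * (N - t)) = exp (a * N) / exp (a * t)"
        by (simp add: right_diff_distrib exp_diff)
      ultimately have "exp (a * (N - t)) * (y N - b / a) \<le> y t - b / a"
        by (simp add: divide_le_eq mult.commute)
      then show ?thesis by simp
    qed
    moreover have "((\<lambda>t. b / a + exp (a * (N - t)) * (y N - b / a)) \<longlongrightarrow> b / a + 0 * (y N - b / a)) at_top"
    proof (intro tendsto_intros)
      have "filterlim (\<lambda>t. a * (N - t)) at_bot at_top"
        using a by real_asymp
      then show "((\<lambda>t. exp (a * (N - t))) \<longlongrightarrow> 0) at_top"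
        by (rule filterlim_compose[OF exp_at_bot])
    qed
    then have "eventually (\<lambda>t. b' < b / a + exp (a * (N - t)) * (y N - b / a)) at_top"
      using b' by (intro order_tendstoD) auto
    then have "eventually (\<lambda>t. y t \<ge> b') at_top"
      using eventually_ge_at_top[of N] by eventually_elim (use calculation in force)
    then show ?thesis ..
  next
    case False
    then have s: "s = -1" using s by auto
    show ?thesis
    proof (cases "\<exists>M\<ge>N. y M < b / a")
      case True
      then obtain M where M: "M \<ge> N" "y M < b / a" by blast
      have "y t \<le> b / a + exp (a * (t - M)) * (y M - b / a)" if "t \<ge> M" for t
      proof -
        have "exp (-a * M) * (- y M - (-b / a)) \<le> exp (-a * t) * (- y t - (-b / a))"
        proof (rule exp_weight_mono)
          show "((\<lambda>t. - y t) has_real_derivative - y' t) (at t)" for t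
            using der by (auto intro!: derivative_eq_intros)
          fix x assume "M \<le> x"
          then show "0 \<le> - a * (- y x - - b / a) + - y' x"
            using N[of x] M s a by (simp add: right_diff_distrib)
        qed (use that in auto)
        then have "exp (-a * M) * (b / a - y M) \<le> exp (-a * t) * (b / a - y t)"
          by simp
        moreover have "exp (a * (t - M)) = exp (-a * M) / exp (-a * t)"
          by (simp add: algebra_simps flip: exp_diff)
        ultimately have "exp (a * (t - M)) * (b / a - y M) \<le> b / a - y t"
          by (simp add: divide_le_eq mult.commute)
        then show ?thesis by (simp add: right_diff_distrib)
      qed
      moreover have "filterlim (\<lambda>t. b / a + exp (a * (t - M)) * (y M - b / a)) at_bot at_top"
      proof -
        have "y M - b / a < 0" using M by simp
        then show ?thesis using a by real_asymp
      qed
      ultimately have "filterlim y at_bot at_top"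
        by (elim filterlim_at_bot_mono) (auto simp: eventually_at_top_linorder)
      then show ?thesis ..
    next
      case False
      then have "\<forall>M\<ge>N. y M \<ge> b'" using b' by force
      then show ?thesis by (auto simp: eventually_at_top_linorder)
    qed
  qed
qed

lemma eventually_le_or_at_top:
  fixes y :: "real \<Rightarrow> real"
  assumes der: "\<And>t. (y has_real_derivative y' t) (at t)"
    and a: "a > 0" and s: "s = 1 \<or> s = -1"
    and ev: "eventually (\<lambda>t. a * y t + s * y' t \<le> b) at_top" and b': "b' > b / a"
  shows "eventually (\<lambda>t. y t \<le> b') at_top \<or> filterlim y at_top at_top"
proof -
  have "eventually (\<lambda>t. - y t \<ge> -b') at_top \<or> filterlim (\<lambda>t. - y t) at_bot at_top"
  proof (rule eventually_ge_or_at_bot)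
    show "((\<lambda>t. - y t) has_real_derivative - y' t) (at t)" for t
      using der by (auto intro!: derivative_eq_intros)
    show "eventually (\<lambda>t. a * - y t + s * - y' t \<ge> - b) at_top"
      using ev by eventually_elim auto
  qed (use a s b' in auto)
  then show ?thesis by (simp add: filterlim_uminus_at_top)
qed

text \<open>The dichotomy is applied at every level Z: either the definite divergence in one
  direction appears outright, or y passes every level in the other. Read contrapositively,
  non-divergence passes from y to its image under the factor.\<close>

lemma diverges_first_order:
  fixes y :: "real \<Rightarrow> real"
  assumes der: "\<And>t. (y has_real_derivative y' t) (at t)"
    and a: "a > 0" and s: "s = 1 \<or> s = -1"
    and div: "diverges (\<lambda>t. a * y t + s * y' t)"
  shows "diverges y"
  using div unfolding diverges_def
proof
  assume *: "filterlim (\<lambda>t. a * y t + s * y' t) at_top at_top"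
  have "eventually (\<lambda>t. y t \<ge> Z) at_top \<or> filterlim y at_bot at_top" for Z
    by (rule eventually_ge_or_at_bot[OF der a s, where b = "a * (Z + 1)"])
      (use * a in \<open>auto simp: filterlim_at_top\<close>)
  then show "filterlim y at_top at_top \<or> filterlim y at_bot at_top"
    unfolding filterlim_at_top by blast
next
  assume *: "filterlim (\<lambda>t. a * y t + s * y' t) at_bot at_top"
  have "eventually (\<lambda>t. y t \<le> Z) at_top \<or> filterlim y at_top at_top" for Z
    by (rule eventually_le_or_at_top[OF der a s, where b = "a * (Z - 1)"])
      (use * a in \<open>auto simp: filterlim_at_bot\<close>)
  then show "filterlim y at_top at_top \<or> filterlim y at_bot at_top"
    unfolding filterlim_at_bot by blast
qed

lemma tendsto_first_order:
  fixes y :: "real \<Rightarrow> real"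
  assumes der: "\<And>t. (y has_real_derivative y' t) (at t)"
    and a: "a > 0" and s: "s = 1 \<or> s = -1"
    and lim: "((\<lambda>t. a * y t + s * y' t) \<longlongrightarrow> l) at_top" and nd: "\<not> diverges y"
  shows "(y \<longlongrightarrow> l / a) at_top"
proof (rule order_tendstoI)
  fix z assume "z < l / a"
  \<comment> \<open>Two midpoints are taken: (z + l / a) / 2 as the level for the equation, and the
    midpoint between it and z for y, because the dichotomy costs a strict margin and the goal is
    strict again.\<close>
  then have "a * ((z + l / a) / 2) < l" using a by (simp add: field_simps)
  then have "eventually (\<lambda>t. a * y t + s * y' t > a * ((z + l / a) / 2)) at_top"
    using lim order_tendstoD(1) by blast
  then have "eventually (\<lambda>t. a * y t + s * y' t \<ge> a * ((z + l / a) / 2)) at_top"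
    by eventually_elim auto
  then have "eventually (\<lambda>t. y t \<ge> (z + (z + l / a) / 2) / 2) at_top \<or> filterlim y at_bot at_top"
    by (rule eventually_ge_or_at_bot[OF der a s]) (use \<open>z < l / a\<close> a in \<open>simp add: field_simps\<close>)
  then have "eventually (\<lambda>t. y t \<ge> (z + (z + l / a) / 2) / 2) at_top"
    using nd diverges_def by auto
  then show "eventually (\<lambda>t. z < y t) at_top"
    by eventually_elim (use \<open>z < l / a\<close> in \<open>auto simp: field_simps\<close>)
next
  fix z assume "z > l / a"
  then have "a * ((z + l / a) / 2) > l" using a by (simp add: field_simps)
  then have "eventually (\<lambda>t. a * y t + s * y' t < a * ((z + l / a) / 2)) at_top"
    using lim order_tendstoD(2) by blast
  then have "eventually (\<lambda>t. a * y t + s * y' t \<le> a * ((z + l / a) / 2)) at_top"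
    by eventually_elim auto
  then have "eventually (\<lambda>t. y t \<le> (z + (z + l / a) / 2) / 2) at_top \<or> filterlim y at_top at_top"
    by (rule eventually_le_or_at_top[OF der a s]) (use \<open>z > l / a\<close> a in \<open>simp add: field_simps\<close>)
  then have "eventually (\<lambda>t. y t \<le> (z + (z + l / a) / 2) / 2) at_top"
    using nd diverges_def by auto
  then show "eventually (\<lambda>t. z > y t) at_top"
    by eventually_elim (use \<open>z > l / a\<close> in \<open>auto simp: field_simps\<close>)
qed

lemma not_diverges: 
  assumes "bounded (range y)"
  shows "\<not> diverges y"
proof -
  obtain B where B: "\<And>t. \<bar>y t\<bar> \<le> B" using assms by (auto simp: bounded_iff)
  have lt: "\<not> B + 1 \<le> y t" "\<not> y t \<le> - B - 1" for t using B[of t] by auto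
  have "\<not> eventually (\<lambda>t. y t \<ge> B + 1) at_top" "\<not> eventually (\<lambda>t. y t \<le> - B - 1) at_top"
    using lt by (auto simp: eventually_at_top_linorder)
  then show ?thesis unfolding diverges_def filterlim_at_top filterlim_at_bot by blast
qed

lemma bounded_first_order:
  assumes y: "tame y" and a: "a > 0" and s: "s = 1 \<or> s = -1"
    and bd: "bounded (range (\<lambda>t. a * y t + s * deriv y t))" and nd: "\<not> diverges y"
  shows "bounded (range y)"
proof -
  note der = tame_DERIV[OF y]
  obtain B where B: "\<And>t. \<bar>a * y t + s * deriv y t\<bar> \<le> B" using bd by (auto simp: bounded_iff)
  have 1: "eventually (\<lambda>t. y t \<ge> (- B) / a - 1) at_top"
  proof -
    have "eventually (\<lambda>t. a * y t + s * deriv y t \<ge> - B) at_top"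
      using B by (intro always_eventually) (metis abs_le_D2 minus_le_iff)
    from eventually_ge_or_at_bot[OF der a s this, of "(- B) / a - 1"] nd
    show ?thesis by (auto simp: diverges_def)
  qed
  have 2: "eventually (\<lambda>t. y t \<le> B / a + 1) at_top"
  proof -
    have "eventually (\<lambda>t. a * y t + s * deriv y t \<le> B) at_top"
      using B by (intro always_eventually) (auto simp: abs_le_iff)
    from eventually_le_or_at_top[OF der a s this, of "B / a + 1"] nd
    show ?thesis by (auto simp: diverges_def)
  qed
  from 1 2 have "eventually (\<lambda>t. \<bar>y t\<bar> \<le> B / a + 1) at_top"
    by eventually_elim auto
  then obtain T where T: "\<And>t. t \<ge> T \<Longrightarrow> \<bar>y t\<bar> \<le> B / a + 1" by (auto simp: eventually_at_top_linorder)
  have "bounded (y ` {T..})" unfolding bounded_iff using T by auto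
  moreover have "{..T} \<union> {T..} = UNIV" by auto
  then have "range y = y ` {..T} \<union> y ` {T..}" by (metis image_Un)
  ultimately show ?thesis using tame_bounded[OF y, of T] by simp
qed

text \<open>Maximum principle on the whole line: a negative value of y would be amplified by exp (a
  d) at distance d, backwards in t for s = 1 and forwards for s = -1, against boundedness.\<close>

lemma nonneg_first_order:
  fixes y :: "real \<Rightarrow> real"
  assumes der: "\<And>t. (y has_real_derivative y' t) (at t)"
    and a: "a > 0" and s: "s = 1 \<or> s = -1"
    and f: "\<And>t. a * y t + s * y' t \<ge> 0" and bd: "bounded (range y)"
  shows "y t \<ge> 0"
proof (rule ccontr)
  assume neg: "\<not> y t \<ge> 0"
  obtain B where B: "\<And>t. \<bar>y t\<bar> \<le> B" using bd by (auto simp: bounded_iff)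
  have "y t * exp (a * d) \<ge> - B" if "d \<ge> 0" for d
  proof (cases "s = 1")
    case True
    have "exp (a * (t - d)) * (y (t - d) - 0) \<le> exp (a * t) * (y t - 0)"
      using f True that by (intro exp_weight_mono[OF der]) auto
    then have "y (t - d) \<le> exp (a * t) / exp (a * (t - d)) * y t"
      by (simp add: field_simps)
    also have "exp (a * t) / exp (a * (t - d)) = exp (a * d)"
      by (simp add: algebra_simps flip: exp_diff)
    finally show ?thesis using B[of "t - d"] by (simp add: mult.commute)
  next
    case False
    then have s: "s = -1" using s by auto
    have "exp (- a * t) * (- y t - 0) \<le> exp (- a * (t + d)) * (- y (t + d) - 0)"
    proof (rule exp_weight_mono)
      show "((\<lambda>t. - y t) has_real_derivative - y' t) (at t)" for t
        using der by (auto intro!: derivative_eq_intros)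
    qed (use f s that in auto)
    then have "exp (- a * (t + d)) * y (t + d) \<le> exp (- a * t) * y t" by simp
    then have "y (t + d) \<le> exp (- a * t) / exp (- a * (t + d)) * y t"
      by (simp add: field_simps)
    also have "exp (- a * t) / exp (- a * (t + d)) = exp (a * d)"
      by (simp add: algebra_simps flip: exp_diff)
    finally show ?thesis using B[of "t + d"] by (simp add: mult.commute)
  qed
  then have "eventually (\<lambda>d. y t * exp (a * d) \<ge> - B) at_top"
    by (intro eventually_at_top_linorderI[of 0])
  moreover have "filterlim (\<lambda>d. y t * exp (a * d)) at_bot at_top"
  proof -
    have "y t < 0" using neg by simp
    then show ?thesis using a by real_asymp
  qed
  then have "eventually (\<lambda>d. y t * exp (a * d) \<le> - B - 1) at_top" unfolding filterlim_at_bot by blast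
  ultimately have "eventually (\<lambda>d::real. False) at_top" by eventually_elim auto
  then show False by simp
qed

section \<open>Chains of first-order factors\<close>

definition lin_prod :: "(real \<times> real) list \<Rightarrow> real poly" where
  "lin_prod xs = prod_list (map (\<lambda>(a, s). [:a, s:]) xs)"

definition factors_ok :: "(real \<times> real) list \<Rightarrow> bool" where
  "factors_ok xs \<longleftrightarrow> (\<forall>(a, s)\<in>set xs. a > 0 \<and> (s = 1 \<or> s = -1))"

text \<open>All partial products applied to y are bounded, from y itself to the full product. Under
  this condition the factors can be inverted one at a time within bounded functions.\<close>

primrec chain_bounded :: "(real \<times> real) list \<Rightarrow> (real \<Rightarrow> real) \<Rightarrow> bool" where
  "chain_bounded [] y \<longleftrightarrow> bounded (range y)"
| "chain_bounded (x # xs) y \<longleftrightarrow> bounded (range y) \<and> chain_bounded xs (dop [:fst x, snd x:] y)"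

lemma dop_linear: "dop [:a, s:] y = (\<lambda>t. a * y t + s * deriv y t)"
  by (rule ext) (simp add: dop_pCons)

lemma dop_lin_prod_Cons: "tame y \<Longrightarrow> dop (lin_prod ((a, s) # xs)) y = dop (lin_prod xs) (dop [:a, s:] y)"
  unfolding lin_prod_def by (rule ext) (simp only: list.map prod_list.Cons prod.case mult.commute[of "[:a, s:]"] dop_mult)

lemma dop_lin_prod_Nil: "dop (lin_prod []) y = y"
  by (simp add: lin_prod_def)

lemma chain_bounded_imp_bounded: "chain_bounded xs y \<Longrightarrow> bounded (range y)"
  by (cases xs) auto

text \<open>Two passes in one induction: non-divergence goes down from y through the factors, and
  boundedness returns upwards from the full product.\<close>

lemma chain_boundedI:
  assumes "factors_ok xs" "tame y" "\<not> diverges y" "bounded (range (dop (lin_prod xs) y))"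
  shows "chain_bounded xs y"
  using assms
proof (induction xs arbitrary: y)
  case (Cons x xs)
  obtain a s where x: "x = (a, s)" by force
  have as: "a > 0" "s = 1 \<or> s = -1" using Cons.prems(1) x by (auto simp: factors_ok_def)
  let ?z = "dop [:a, s:] y"
  have "\<not> diverges ?z"
    using diverges_first_order[OF tame_DERIV[OF Cons.prems(2)] as] Cons.prems(3) by (auto simp: dop_linear)
  then have *: "chain_bounded xs ?z"
    using Cons by (intro Cons.IH tame_dop) (auto simp: factors_ok_def x dop_lin_prod_Cons)
  then have "bounded (range y)"
    using bounded_first_order[OF Cons.prems(2) as] Cons.prems(3) chain_bounded_imp_bounded[OF *]
    by (auto simp: dop_linear)
  then show ?case using * x by simp
qed (simp add: dop_lin_prod_Nil)

text \<open>The bounded inverse of each factor preserves positivity, hence so does their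
  composition.\<close>

lemma chain_nonneg:
  assumes "factors_ok xs" "tame y" "chain_bounded xs y" "\<And>t. dop (lin_prod xs) y t \<ge> 0"
  shows "y t \<ge> 0"
  using assms
proof (induction xs arbitrary: y t)
  case (Cons x xs)
  obtain a s where x: "x = (a, s)" by force
  have as: "a > 0" "s = 1 \<or> s = -1" using Cons.prems(1) x by (auto simp: factors_ok_def)
  have "dop [:a, s:] y t \<ge> 0" for t
    by (rule Cons.IH) (use Cons.prems x in \<open>auto simp: factors_ok_def dop_lin_prod_Cons tame_dop\<close>)
  then show ?case
    using nonneg_first_order[OF tame_DERIV[OF Cons.prems(2)] as] Cons.prems(3) chain_bounded_imp_bounded
    by (auto simp: dop_linear)
qed (simp add: dop_lin_prod_Nil)

text \<open>Inverting a factor divides the limit by its zero-order coefficient a; the product of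
  these coefficients is the symbol at 0.\<close>

lemma chain_tendsto:
  assumes "factors_ok xs" "tame y" "chain_bounded xs y" "(dop (lin_prod xs) y \<longlongrightarrow> l) at_top"
  shows "(y \<longlongrightarrow> l / coeff (lin_prod xs) 0) at_top"
  using assms
proof (induction xs arbitrary: y)
  case (Cons x xs)
  obtain a s where x: "x = (a, s)" by force
  have as: "a > 0" "s = 1 \<or> s = -1" using Cons.prems(1) x by (auto simp: factors_ok_def)
  have "(dop [:a, s:] y \<longlongrightarrow> l / coeff (lin_prod xs) 0) at_top"
    using Cons.prems x by (intro Cons.IH tame_dop) (auto simp: factors_ok_def dop_lin_prod_Cons)
  then have "(y \<longlongrightarrow> l / coeff (lin_prod xs) 0 / a) at_top"
    using Cons.prems(3) not_diverges[of y]
    by (intro tendsto_first_order[OF tame_DERIV[OF Cons.prems(2)] as]) (auto simp: dop_linear)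
  moreover have "coeff (lin_prod (x # xs)) 0 = coeff (lin_prod xs) 0 * a"
    by (simp add: x lin_prod_def coeff_mult)
  ultimately show ?case by (simp add: field_simps)
qed (simp add: dop_lin_prod_Nil lin_prod_def)

text \<open>One forward and one backward factor suffice for strict positivity: a zero of y propagates
  to the left through a + D, and then to the right through b - D.\<close>

lemma chain_zero_imp:
  assumes ok: "factors_ok xs" and xs: "xs = (a, 1) # (b, -1) # ys" and y: "tame y" and cb: "chain_bounded xs y"
    and nn: "\<And>t. dop (lin_prod xs) y t \<ge> 0" and y0: "y t0 = 0"
  shows "dop (lin_prod xs) y t = 0"
proof -
  define z where "z = dop [:a, 1:] y"
  define w where "w = dop [:b, -1:] z"
  have z: "tame z" and w: "tame w" by (auto simp: z_def w_def y tame_dop)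
  have eq: "dop (lin_prod xs) y = dop (lin_prod ((b, -1) # ys)) z" "dop (lin_prod xs) y = dop (lin_prod ys) w"
    by (simp_all add: xs w_def z_def dop_lin_prod_Cons y tame_dop)
  have cbz: "chain_bounded ((b, -1) # ys) z" and cbw: "chain_bounded ys w"
    using cb by (simp_all add: xs z_def w_def)
  have y_nn: "y t \<ge> 0" for t by (rule chain_nonneg[OF ok y cb nn])
  have z_nn: "z t \<ge> 0" for t
    by (rule chain_nonneg[OF _ z cbz]) (use ok xs nn eq in \<open>auto simp: factors_ok_def\<close>)
  have w_nn: "w t \<ge> 0" for t
    by (rule chain_nonneg[OF _ w cbw]) (use ok xs nn eq in \<open>auto simp: factors_ok_def\<close>)
  have y_left: "y t = 0" if "t \<le> t0" for t
  proof -
    have "exp (a * t) * (y t - 0) \<le> exp (a * t0) * (y t0 - 0)"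
      using z_nn by (intro exp_weight_mono[OF tame_DERIV[OF y]] that) (auto simp: z_def dop_linear)
    then show ?thesis using y0 y_nn[of t] by (simp add: mult_le_0_iff)
  qed
  have z_left: "z t = 0" if "t < t0" for t
  proof -
    \<comment> \<open>The derivative of y is read off from local vanishing, which is why z is
      obtained only strictly to the left of t0.\<close>
    have "eventually (\<lambda>x. y x = 0) (nhds t)"
      using eventually_nhds_in_open[of "{..<t0}" t] that by (auto elim!: eventually_mono intro: y_left)
    then have "deriv y t = deriv (\<lambda>x. 0) t" by (rule deriv_cong_ev) simp
    then show ?thesis using y_left[of t] that by (simp add: z_def dop_linear)
  qed
  have z_zero: "z t = 0" for t
  proof (cases "t < t0")
    case False
    \<comment> \<open>Since w \<ge> 0, the function - exp (- b t) z is nondecreasing. The base point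
      t0 - 1 lies in the open half-line where z vanishes, so z \<le> 0 to its right.\<close>
    have "exp (- b * (t0 - 1)) * (- z (t0 - 1) - 0) \<le> exp (- b * t) * (- z t - 0)"
    proof (rule exp_weight_mono)
      show "((\<lambda>t. - z t) has_real_derivative - deriv z t) (at t)" for t
        using tame_DERIV[OF z] by (auto intro!: derivative_eq_intros)
    qed (use w_nn False in \<open>auto simp: w_def dop_linear\<close>)
    then show ?thesis using z_left[of "t0 - 1"] z_nn[of t] by (simp add: mult_le_0_iff)
  qed (use z_left in auto)
  then have "z = (\<lambda>t. 0)" by auto
  then show ?thesis using eq(1) by (simp add: dop_const)
qed

section \<open>The sliding argument\<close>

lemma nonneg_from_bot:
  fixes h :: "real \<Rightarrow> real"
  assumes "(h \<longlongrightarrow> 0) at_bot" and "\<And>t. (h has_real_derivative h' t) (at t)"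
    and "\<And>t. t \<le> T \<Longrightarrow> h' t \<ge> 0" and "t \<le> T"
  shows "h t \<ge> 0"
proof (rule tendsto_upperbound[OF assms(1)])
  show "eventually (\<lambda>s. h s \<le> h t) at_bot"
    using eventually_le_at_bot[of t]
  proof eventually_elim
    case (elim s)
    show ?case
    proof (rule DERIV_nonneg_imp_nondecreasing[OF elim])
      fix x assume "s \<le> x" "x \<le> t"
      then show "\<exists>y. (h has_real_derivative y) (at x) \<and> 0 \<le> y"
        using assms by (intro exI[of _ "h' x"]) auto
    qed
  qed
qed simp

lemma nonneg_from_top:
  fixes h :: "real \<Rightarrow> real"
  assumes "(h \<longlongrightarrow> 0) at_top" and der: "\<And>t. (h has_real_derivative h' t) (at t)"
    and "\<And>t. t \<ge> T \<Longrightarrow> h' t \<le> 0" and "t \<ge> T"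
  shows "h t \<ge> 0"
proof -
  have "h (- (- t)) \<ge> 0"
  proof (rule nonneg_from_bot[where h = "\<lambda>s. h (- s)" and h' = "\<lambda>s. - h' (- s)" and T = "- T"])
    show "((\<lambda>s. h (- s)) \<longlongrightarrow> 0) at_bot"
      using assms(1) by (simp add: filterlim_at_top_mirror)
    show "((\<lambda>s. h (- s)) has_real_derivative - h' (- t)) (at t)" for t
      using der[of "- t"] by (simp add: DERIV_mirror)
  qed (use assms in auto)
  then show ?thesis by simp
qed

text \<open>Index 1 is the unknown solution, index 2 the reference profile. The common limits of P1
  and P2 allow comparison from both ends: U1 \<le> U2 on a left half-line and U1 \<ge> U2 on a right
  one each give P1 \<le> P2 there (\<open>cmp_bot\<close>, \<open>cmp_top\<close>). An increasing
  difference of the two U has exactly this sign pattern, which is why strict positivity of its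
  derivative decides the argument.\<close>

lemma sliding_unique:
  fixes p1 p2 U1 U2 :: "real \<Rightarrow> real" and xs :: "(real \<times> real) list"
  defines "P1 \<equiv> dop (lin_prod xs) p1" and "P2 \<equiv> dop (lin_prod xs) p2"
  assumes ok: "factors_ok xs" and xs: "xs = (a, 1) # (b, -1) # ys"
    and tm: "tame p1" "tame p2" and bd: "bounded (range p1)" "bounded (range p2)"
    and U1: "\<And>t. (U1 has_real_derivative 1 - p1 t) (at t)"
    and U2: "\<And>t. (U2 has_real_derivative 1 - p2 t) (at t)"
    and dP1: "\<And>t. deriv P1 t = \<kappa> * exp (N * U1 t)"
    and dP2: "\<And>t. deriv P2 t = \<kappa> * exp (N * U2 t)"
    and pos: "\<kappa> > 0" "N > 0" "M > 0"
    and bot: "(P1 \<longlongrightarrow> 0) at_bot" "(P2 \<longlongrightarrow> 0) at_bot"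
    and top: "(P1 \<longlongrightarrow> M) at_top" "(P2 \<longlongrightarrow> M) at_top"
    and p1_le: "\<And>t. p1 t \<le> 2" and U1_bot: "\<And>t. t \<le> Tb \<Longrightarrow> U1 t \<le> t + Cb"
    and U2_bd: "\<And>t. - \<bar>t\<bar> \<le> U2 t" "\<And>t. U2 t \<le> - \<bar>t\<bar> + B"
    and p2_bd: "\<And>t. 0 \<le> p2 t" "\<And>t. p2 t \<le> 2"
  shows "\<exists>l. \<forall>t. U1 t = U2 (t + l)"
proof -
  have tP: "tame P1" "tame P2" unfolding P1_def P2_def by (simp_all add: tm tame_dop)
  have DP1: "(P1 has_real_derivative \<kappa> * exp (N * U1 t)) (at t)" for t
    using tame_DERIV[OF tP(1)] dP1 by simp
  have DP2: "(P2 has_real_derivative \<kappa> * exp (N * U2 t)) (at t)" for t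
    using tame_DERIV[OF tP(2)] dP2 by simp
  have DP2s: "((\<lambda>t. P2 (t + l)) has_real_derivative \<kappa> * exp (N * U2 (t + l))) (at t)" for t l
    using DP2 by (simp flip: DERIV_shift)
  have U2s: "((\<lambda>t. U2 (t + l)) has_real_derivative 1 - p2 (t + l)) (at t)" for t l
    using U2 by (simp flip: DERIV_shift)
  have botl: "((\<lambda>t. P2 (t + l)) \<longlongrightarrow> 0) at_bot" for l
    by (rule filterlim_compose[OF bot(2)]) real_asymp
  have topl: "((\<lambda>t. P2 (t + l)) \<longlongrightarrow> M) at_top" for l
    by (rule filterlim_compose[OF top(2)]) real_asymp
  have m1: "P1 s < P1 t" and m2: "P2 s < P2 t" if "s < t" for s t
    using that DP1 DP2 pos by (blast intro: DERIV_pos_imp_increasing mult_pos_pos exp_gt_zero)+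
  have P_nonneg: "P1 t \<ge> 0" "P2 t \<ge> 0" for t
    using nonneg_from_bot[OF bot(1) DP1, of t t] nonneg_from_bot[OF bot(2) DP2, of t t] pos by auto
  have P_pos: "P1 t > 0" "P2 t > 0" for t
    using m1[of "t - 1" t] m2[of "t - 1" t] P_nonneg[of "t - 1"] by auto

  have cmp_bot: "P1 t \<le> P2 (t + l)" if "\<And>t. t \<le> T \<Longrightarrow> U1 t \<le> U2 (t + l)" "t \<le> T" for t l T
  proof -
    have "0 \<le> P2 (t + l) - P1 t"
    proof (rule nonneg_from_bot[where T = T and t = t and h = "\<lambda>t. P2 (t + l) - P1 t"
          and h' = "\<lambda>t. \<kappa> * exp (N * U2 (t + l)) - \<kappa> * exp (N * U1 t)"])
      show "((\<lambda>t. P2 (t + l) - P1 t) \<longlongrightarrow> 0) at_bot"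
        using tendsto_diff[OF botl bot(1)] by simp
    qed (use that pos in \<open>auto intro!: derivative_intros DP1 DP2s\<close>)
    then show ?thesis by simp
  qed
  have cmp_top: "P1 t \<le> P2 (t + l)" if "\<And>t. t \<ge> T \<Longrightarrow> U1 t \<ge> U2 (t + l)" "t \<ge> T" for t l T
  proof -
    have "0 \<le> P2 (t + l) - P1 t"
    proof (rule nonneg_from_top[where T = T and t = t and h = "\<lambda>t. P2 (t + l) - P1 t"
          and h' = "\<lambda>t. \<kappa> * exp (N * U2 (t + l)) - \<kappa> * exp (N * U1 t)"])
      show "((\<lambda>t. P2 (t + l) - P1 t) \<longlongrightarrow> 0) at_top"
        using tendsto_diff[OF topl top(1)] by simp
    qed (use that pos in \<open>auto intro!: derivative_intros DP1 DP2s\<close>)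
    then show ?thesis by simp
  qed

  \<comment> \<open>As P2 is increasing, the translate t \<mapsto> P2 (t + l) rises with l, so the
    extremal position is an infimum.\<close>
  define \<Lambda> where "\<Lambda> = {l. \<forall>t. P1 t \<le> P2 (t + l)}"
  have "\<exists>l. l \<in> \<Lambda>"
  proof -
    have "eventually (\<lambda>t. P1 t < P2 0) at_bot"
      using bot(1) P_pos(2)[of 0] by (rule order_tendstoD)
    then obtain t1 where t1: "\<And>t. t \<le> t1 \<Longrightarrow> P1 t < P2 0" by (auto simp: eventually_at_bot_linorder)
    define t0 where "t0 = min t1 Tb"
    have U1_top: "U1 t \<ge> - t + (t0 + U1 t0)" if "t \<ge> t0" for t
    proof -
      have "U1 t0 + t0 \<le> U1 t + t"
      proof (rule DERIV_nonneg_imp_nondecreasing[OF that])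
        fix x
        show "\<exists>y. ((\<lambda>t. U1 t + t) has_real_derivative y) (at x) \<and> 0 \<le> y"
          using p1_le[of x] by (intro exI[of _ "1 - p1 x + 1"]) (auto intro!: derivative_eq_intros U1)
      qed
      then show ?thesis by simp
    qed
    \<comment> \<open>The first entry gives U2 (t + l) \<le> U1 t for t \<ge> t0, the last gives U1
      t \<le> U2 (t + l) for t \<le> - l, and - t0 ensures - l \<le> t0 \<le> Tb. Between - l and t0
      the value P2 0 separates the two functions.\<close>
    define l where "l = max (max (B - t0 - U1 t0) (- t0)) Cb"
    have l: "B - t0 - U1 t0 \<le> l" "- l \<le> t0" "Cb \<le> l" "t0 \<le> Tb"
      unfolding l_def by linarith+ (simp add: t0_def)
    have "P1 t \<le> P2 (t + l)" for t
    proof -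
      consider "t \<ge> t0" | "t \<le> - l" | "- l < t" "t < t0" by linarith
      then show ?thesis
      proof cases
        case 1
        show ?thesis
        proof (rule cmp_top[OF _ 1])
          fix s assume "t0 \<le> s"
          then show "U2 (s + l) \<le> U1 s"
            using U1_top[of s] U2_bd(2)[of "s + l"] l by linarith
        qed
      next
        case 2
        show ?thesis
        proof (rule cmp_bot[OF _ 2])
          fix s assume "s \<le> - l"
          then show "U1 s \<le> U2 (s + l)"
            using U1_bot[of s] U2_bd(1)[of "s + l"] l by linarith
        qed
      next
        case 3
        have "P2 0 < P2 (t + l)" using 3 by (intro m2) auto
        moreover have "P1 t < P2 0" using 3 by (intro t1) (auto simp: t0_def)
        ultimately show ?thesis by simp
      qed
    qed
    then show ?thesis by (auto simp: \<Lambda>_def)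
  qed
  moreover have bdd: "bdd_below \<Lambda>"
  proof -
    have "eventually (\<lambda>t. P2 t < P1 0) at_bot"
      using bot(2) P_pos(1)[of 0] by (rule order_tendstoD)
    then obtain t1 where t1: "\<And>t. t \<le> t1 \<Longrightarrow> P2 t < P1 0" by (auto simp: eventually_at_bot_linorder)
    have "t1 \<le> l" if "l \<in> \<Lambda>" for l
    proof (rule ccontr)
      assume "\<not> t1 \<le> l"
      then have "P2 l < P1 0" by (intro t1) auto
      moreover have "P1 0 \<le> P2 (0 + l)" using that unfolding \<Lambda>_def by blast
      ultimately show False by simp
    qed
    then show ?thesis by (intro bdd_belowI)
  qed
  moreover have "closed \<Lambda>"
  proof -
    have "\<Lambda> = (\<Inter>t. {l. P1 t \<le> P2 (t + l)})" by (auto simp: \<Lambda>_def)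
    moreover have "closed {l. P1 t \<le> P2 (t + l)}" for t
      by (intro closed_Collect_le continuous_intros continuous_on_compose2[OF tame_continuous[OF tP(2), of UNIV]]) auto
    ultimately show ?thesis by auto
  qed
  ultimately have "Inf \<Lambda> \<in> \<Lambda>" by (intro closed_contains_Inf) auto
  define l where "l = Inf \<Lambda>"
  define q where "q = (\<lambda>t. p2 (t + l))"
  define Q where "Q = (\<lambda>t. P2 (t + l))"
  have le: "P1 t \<le> Q t" for t using \<open>Inf \<Lambda> \<in> \<Lambda>\<close> by (auto simp: \<Lambda>_def l_def Q_def)
  \<comment> \<open>\<open>g\<close> is the derivative of U1 - U2 (. + l), and the operator of
    \<open>xs\<close> maps it to the nonnegative gap Q - P1.\<close>
  define g where "g = (\<lambda>t. 1 * q t + (-1) * p1 t)"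
  have tq: "tame q" unfolding q_def by (rule tame_shift[OF tm(2)])
  have tg: "tame g" unfolding g_def by (rule tame_lincomb[OF tq tm(1)])
  have dg: "dop (lin_prod xs) g = (\<lambda>t. Q t - P1 t)"
    unfolding g_def using dop_lincomb[OF tq tm(1), of "lin_prod xs" 1 "-1"]
    by (auto simp: fun_eq_iff q_def dop_shift[OF tm(2)] Q_def P1_def P2_def)
  have bg: "bounded (range g)"
  proof -
    have "range q \<subseteq> range p2" by (auto simp: q_def)
    then have "bounded (range q)" using bd bounded_subset by blast
    then show ?thesis unfolding g_def by (intro bounded_image_lincomb bd)
  qed
  have DM: "((\<lambda>t. M - P1 t) has_real_derivative - (\<kappa> * exp (N * U1 t))) (at t)"
    "((\<lambda>t. M - P2 t) has_real_derivative - (\<kappa> * exp (N * U2 t))) (at t)" for t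
    using DERIV_diff[OF DERIV_const DP1, of M t] DERIV_diff[OF DERIV_const DP2, of M t] by simp_all
  have P_le: "P1 t \<le> M" "P2 t \<le> M" for t
    using nonneg_from_top[OF _ DM(1), of t t] nonneg_from_top[OF _ DM(2), of t t]
      tendsto_diff[OF tendsto_const[of M] top(1)] tendsto_diff[OF tendsto_const[of M] top(2)] pos
    by auto
  have bQ: "bounded (range (dop (lin_prod xs) g))"
  proof -
    have "\<bar>Q t - P1 t\<bar> \<le> M" for t
      using P_le(1)[of t] P_le(2)[of "t + l"] P_nonneg(1)[of t] P_nonneg(2)[of "t + l"] by (auto simp: Q_def)
    then show ?thesis by (auto simp: bounded_iff dg)
  qed
  have cg: "chain_bounded xs g"
    by (rule chain_boundedI[OF ok tg not_diverges[OF bg] bQ])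
  have g_nn: "g t \<ge> 0" for t by (rule chain_nonneg[OF ok tg cg]) (simp add: dg le)
  have Dd: "((\<lambda>t. U1 t - U2 (t + l)) has_real_derivative g t) (at t)" for t
    using DERIV_diff[OF U1 U2s] by (simp add: g_def q_def)
  have DQ: "((\<lambda>t. Q t - P1 t) has_real_derivative \<kappa> * exp (N * U2 (t + l)) - \<kappa> * exp (N * U1 t)) (at t)" for t
    unfolding Q_def by (intro derivative_intros DP1 DP2s)
  have contQ: "continuous_on S (\<lambda>t. Q t - P1 t)" for S
    using DERIV_continuous_on[OF has_field_derivative_at_within[OF DQ]] .
  show ?thesis
  proof (cases "\<exists>t0. g t0 = 0")
    case True
    then have "Q t - P1 t = 0" for t
      using chain_zero_imp[OF ok xs tg cg] by (auto simp: dg le)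
    then have "(\<lambda>t. Q t - P1 t) = (\<lambda>t. 0)" by auto
    then have "\<kappa> * exp (N * U2 (t + l)) - \<kappa> * exp (N * U1 t) = 0" for t
      using DQ[of t] DERIV_unique[OF _ DERIV_const] by metis
    then show ?thesis using pos by (intro exI[of _ l]) auto
  next
    case False
    then have g_pos: "g t > 0" for t using g_nn[of t] by (metis less_eq_real_def)
    define d where "d = (\<lambda>t. U1 t - U2 (t + l))"
    have d_mono: "d s < d t" if "s < t" for s t
      unfolding d_def by (rule DERIV_pos_imp_increasing[OF that]) (use Dd g_pos in blast)
    \<comment> \<open>At a contact point the gap Q - P1 is minimal, so its derivative vanishes and d
      = 0 there. Beyond that point d > 0, so the gap would fall below zero.\<close>
    have lt: "P1 t < Q t" for t
    proof (rule ccontr)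
      assume "\<not> P1 t < Q t"
      then have eq: "Q t - P1 t = 0" using le[of t] by simp
      have "\<kappa> * exp (N * U2 (t + l)) - \<kappa> * exp (N * U1 t) = 0"
        by (rule DERIV_local_min[OF DQ zero_less_one]) (use le eq in auto)
      then have d0: "d t = 0" using pos by (simp add: d_def)
      have "Q (t + 1) - P1 (t + 1) < Q t - P1 t"
      proof (rule DERIV_neg_imp_decreasing_open[where f = "\<lambda>t. Q t - P1 t"])
        fix x assume "t < x"
        then have "d x > 0" using d_mono d0 by force
        then have "\<kappa> * exp (N * U2 (x + l)) - \<kappa> * exp (N * U1 x) < 0" using pos by (simp add: d_def)
        then show "\<exists>y. ((\<lambda>t. Q t - P1 t) has_real_derivative y) (at x) \<and> y < 0" using DQ by blast
      qed (auto intro: contQ)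
      then show False using le[of "t + 1"] eq by simp
    qed
    \<comment> \<open>If d were nowhere negative, P1 would grow at least as fast as Q from the
      common limit 0 at -\<infinity>, against P1 < Q. The common limit M at +\<infinity> gives a
      point with d > 0 in the same way.\<close>
    have "\<exists>t. d t < 0"
    proof (rule ccontr)
      assume "\<nexists>t. d t < 0"
      then have ge: "U2 (t + l) \<le> U1 t" for t by (force simp: d_def not_less)
      have "0 \<le> P1 0 - Q 0"
        by (rule nonneg_from_bot[where T = 0 and t = 0 and h = "\<lambda>t. P1 t - Q t"
          and h' = "\<lambda>t. \<kappa> * exp (N * U1 t) - \<kappa> * exp (N * U2 (t + l))"])
         (use tendsto_diff[OF bot(1) botl[of l]] pos ge in \<open>auto intro!: derivative_intros DP1 DP2s simp: Q_def\<close>)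
      then show False using lt[of 0] by simp
    qed
    then obtain t1 where t1: "d t1 < 0" by blast
    have "\<exists>t. d t > 0"
    proof (rule ccontr)
      assume "\<nexists>t. d t > 0"
      then have ge: "U2 (t + l) \<ge> U1 t" for t by (force simp: d_def not_less)
      have "0 \<le> P1 0 - Q 0"
        by (rule nonneg_from_top[where T = 0 and t = 0 and h = "\<lambda>t. P1 t - Q t"
          and h' = "\<lambda>t. \<kappa> * exp (N * U1 t) - \<kappa> * exp (N * U2 (t + l))"])
         (use tendsto_diff[OF top(1) topl[of l]] pos ge in \<open>auto intro!: derivative_intros DP1 DP2s simp: Q_def\<close>)
      then show False using lt[of 0] by simp
    qed
    then obtain t2 where t2: "d t2 > 0" by blast
    have "t1 < t2" using t1 t2 d_mono by (metis less_asym less_linear less_trans)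
    obtain e where e: "e > 0" "\<And>t. t1 \<le> t \<Longrightarrow> t \<le> t2 \<Longrightarrow> e \<le> Q t - P1 t"
    proof -
      obtain x where "x \<in> {t1..t2}" "\<And>y. y \<in> {t1..t2} \<Longrightarrow> Q x - P1 x \<le> Q y - P1 y"
        using continuous_attains_inf[OF _ _ contQ, of "{t1..t2}"] \<open>t1 < t2\<close> by auto
      then show ?thesis using lt[of x] by (intro that[of "Q x - P1 x"]) auto
    qed
    have lip: "\<bar>U2 s - U2 t\<bar> \<le> 1 * \<bar>s - t\<bar>" for s t
    proof (rule field_differentiable_bound[where S = "UNIV :: real set", unfolded real_norm_def])
      show "(U2 has_field_derivative 1 - p2 z) (at z within UNIV)" for z using U2 by simp
      show "\<bar>1 - p2 z\<bar> \<le> 1" for z using p2_bd[of z] by auto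
    qed auto
    define K where "K = \<kappa> * exp (N * B)"
    have "K > 0" using pos by (simp add: K_def)
    have lip2: "\<bar>P2 s - P2 t\<bar> \<le> K * \<bar>s - t\<bar>" for s t
    proof (rule field_differentiable_bound[where S = "UNIV :: real set", unfolded real_norm_def])
      show "(P2 has_field_derivative \<kappa> * exp (N * U2 z)) (at z within UNIV)" for z using DP2 by simp
      have "U2 z \<le> B" for z using U2_bd(2)[of z] by simp
      then show "\<bar>\<kappa> * exp (N * U2 z)\<bar> \<le> K" for z using pos by (simp add: K_def)
    qed auto
    \<comment> \<open>A shift by s changes U2 by at most s and P2 by at most K s. Hence the signs of
      d survive outside [t1, t2], where d is beyond d t1 or d t2, and the gap e survives
      inside.\<close>
    define s where "s = min (min (- d t1) (d t2)) (e / K)"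
    have s: "s > 0" "s \<le> - d t1" "s \<le> d t2" "K * s \<le> e"
      using t1 t2 e \<open>K > 0\<close> by (simp_all add: s_def min_le_iff_disj pos_le_divide_eq[symmetric] mult.commute[of K])
    have "P1 t \<le> P2 (t + (l - s))" for t
    proof -
      consider "t \<le> t1" | "t \<ge> t2" | "t1 \<le> t" "t \<le> t2" by linarith
      then show ?thesis
      proof cases
        case 1
        show ?thesis
        proof (rule cmp_bot[OF _ 1])
          fix x assume "x \<le> t1"
          then have "d x \<le> d t1" using d_mono by (metis less_eq_real_def)
          then show "U1 x \<le> U2 (x + (l - s))"
            using lip[of "x + (l - s)" "x + l"] s by (auto simp: d_def)
        qed
      next
        case 2
        show ?thesis
        proof (rule cmp_top[OF _ 2])
          fix x assume "t2 \<le> x"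
          then have "d t2 \<le> d x" using d_mono by (metis less_eq_real_def)
          then show "U2 (x + (l - s)) \<le> U1 x"
            using lip[of "x + (l - s)" "x + l"] s by (auto simp: d_def)
        qed
      next
        case 3
        have "P2 (t + l) - P2 (t + l - s) \<le> K * s" using s lip2[of "t + l" "t + l - s"] by simp
        then show ?thesis using e(2)[OF 3] s by (simp add: Q_def algebra_simps)
      qed
    qed
    then have "l - s \<in> \<Lambda>" by (simp add: \<Lambda>_def)
    then have "l \<le> l - s" unfolding l_def using bdd by (rule cInf_lower)
    then show ?thesis using s by simp
  qed
qed

section \<open>The round profile\<close>

text \<open>Together with the factor - D^2 this is the radial part of the GJMS operator of order n =
  2 m on the cylinder. Interleaving the signs puts a forward and a backward factor at the head, the
  shape required for strict positivity.\<close>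

definition gjms_factors :: "nat \<Rightarrow> (real \<times> real) list" where
  "gjms_factors m = concat (map (\<lambda>j. [(2 * real j, 1), (2 * real j, -1)]) [1..<m])"

lemma factors_ok_gjms: "factors_ok (gjms_factors m)"
  by (auto simp: factors_ok_def gjms_factors_def)

lemma gjms_factors_Cons:
  assumes "m \<ge> 2"
  shows "\<exists>ys. gjms_factors m = (2, 1) # (2, -1) # ys"
proof -
  have "[1..<m] = 1 # [2..<m]" using assms by (subst upt_conv_Cons) (auto simp: numeral_2_eq_2)
  then show ?thesis by (simp add: gjms_factors_def)
qed

lemma lin_prod_append: "lin_prod (xs @ ys) = lin_prod xs * lin_prod ys"
  by (simp add: lin_prod_def)

lemma lin_prod_gjms_Suc:
  "m \<ge> 1 \<Longrightarrow> lin_prod (gjms_factors (Suc m)) = [:4 * (real m)\<^sup>2, 0, -1:] * lin_prod (gjms_factors m)"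
  by (simp add: gjms_factors_def lin_prod_append) (simp add: lin_prod_def power2_eq_square mult.commute)

text \<open>L(0) is the product of (2 j)^2 over 0 < j < m.\<close>

lemma coeff_gjms_0:
  "m \<ge> 1 \<Longrightarrow> coeff (lin_prod (gjms_factors m)) 0 = 4 ^ (m - 1) * (fact (m - 1))\<^sup>2"
proof (induction m rule: dec_induct)
  case base
  then show ?case by (simp add: gjms_factors_def lin_prod_def)
next
  case (step m)
  then obtain k where "m = Suc k" by (cases m) auto
  then show ?case using step
    by (simp add: lin_prod_gjms_Suc coeff_mult power2_eq_square algebra_simps)
qed

section \<open>Polynomials in tanh\<close>

lemma DERIV_poly_tanh:
  "((\<lambda>t. poly r (tanh t)) has_real_derivative poly (pderiv r * [:1, 0, -1:]) (tanh t)) (at t)"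
proof -
  have "((\<lambda>t. poly r (tanh t)) has_real_derivative poly (pderiv r) (tanh t) * (1 - (tanh t)\<^sup>2)) (at t)"
    by (rule DERIV_chain2[OF poly_DERIV]) (auto intro!: derivative_eq_intros)
  then show ?thesis by (simp add: power2_eq_square algebra_simps)
qed

lemma tame_poly_tanh: "tame (\<lambda>t. poly r (tanh t))"
proof (rule tame_coinduct[where \<Phi> = "\<lambda>y. \<exists>r. y = (\<lambda>t. poly r (tanh t))"])
  fix y :: "real \<Rightarrow> real" assume "\<exists>r. y = (\<lambda>t. poly r (tanh t))"
  then obtain r where y: "y = (\<lambda>t. poly r (tanh t))" by blast
  have "compact (poly r ` {-1..1})"
    by (intro compact_continuous_image continuous_intros compact_Icc)
  moreover have "y ` {..T} \<subseteq> poly r ` {-1..1}" for T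
    unfolding y using tanh_real_bounds by (auto intro!: imageI simp: less_imp_le) 
  ultimately have "bounded (y ` {..T})" for T
    by (rule bounded_subset[OF compact_imp_bounded])
  then show "\<exists>y'. (\<exists>r. y' = (\<lambda>t. poly r (tanh t))) \<and>
      (\<forall>t. (y has_real_derivative y' t) (at t)) \<and> (\<forall>T. bounded (y ` {..T}))"
    unfolding y
    by (intro exI[of _ "\<lambda>t. poly (pderiv r * [:1, 0, -1:]) (tanh t)"] conjI allI DERIV_poly_tanh
        exI[of _ "pderiv r * [:1, 0, -1:]"] refl) auto
qed blast

text \<open>Every derivative of a polynomial in tanh carries the factor 1 - tanh^2, which vanishes
  in the limit where tanh = \<plusminus>1; only the zero-order term of the symbol survives.\<close>

lemma dop_poly_tanh_tendsto:
  fixes F :: "real filter"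
  assumes "(tanh \<longlongrightarrow> e) F" "e\<^sup>2 = 1"
  shows "(dop q (\<lambda>t. poly r (tanh t)) \<longlongrightarrow> coeff q 0 * poly r e) F"
proof (induction q arbitrary: r)
  case (pCons a q)
  have "((\<lambda>t. a * poly r (tanh t) + dop q (\<lambda>t. poly (pderiv r * [:1, 0, -1:]) (tanh t)) t)
      \<longlongrightarrow> a * poly r e + coeff q 0 * poly (pderiv r * [:1, 0, -1:]) e) F"
    by (intro tendsto_add tendsto_mult tendsto_const pCons.IH tendsto_poly assms)
  moreover have "poly (pderiv r * [:1, 0, -1:]) e = 0" using assms(2) by (simp add: power2_eq_square)
  moreover have "dop (pCons a q) (\<lambda>t. poly r (tanh t)) =
      (\<lambda>t. a * poly r (tanh t) + dop q (\<lambda>t. poly (pderiv r * [:1, 0, -1:]) (tanh t)) t)"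
    by (simp only: fun_eq_iff dop_pCons deriv_eqI[OF DERIV_poly_tanh]) simp
  ultimately show ?case by (simp only:) simp
qed simp

text \<open>With S = 1 - tanh^2 one has (4 m^2 - D^2) S^m = 2 m (2 m + 1) S^(m + 1), and 2 m (2 m +
  1) (2 m - 1)! = (2 m + 1)!. Geometrically, the round sphere has Q-curvature (n - 1)!.\<close>

lemma dop_gjms_sech:
  "m \<ge> 1 \<Longrightarrow> dop (lin_prod (gjms_factors m)) (\<lambda>t. 1 - (tanh t)\<^sup>2) = (\<lambda>t. fact (2 * m - 1) * (1 - (tanh t)\<^sup>2) ^ m)"
proof (induction m rule: dec_induct)
  case base
  then show ?case by (simp add: gjms_factors_def lin_prod_def)
next
  case (step m)
  define q :: "real \<Rightarrow> real" where "q = (\<lambda>t. 1 - (tanh t)\<^sup>2)"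
  have q: "q = (\<lambda>t. poly [:1, 0, -1:] (tanh t))" by (simp add: q_def power2_eq_square)
  have tq: "tame q" unfolding q by (rule tame_poly_tanh)
  obtain k where k: "m = Suc k" using step by (cases m) auto
  have D1: "((\<lambda>t. F * q t ^ m) has_real_derivative - 2 * F * real m * tanh t * q t ^ m) (at t)" for t F
  proof -
    have "(q has_real_derivative - 2 * tanh t * q t) (at t)"
      unfolding q_def by (auto intro!: derivative_eq_intros)
    from DERIV_cmult[OF DERIV_power_Suc[OF this, of k], of F] show ?thesis
      by (simp add: k algebra_simps)
  qed
  have D2: "((\<lambda>t. - 2 * F * real m * tanh t * q t ^ m) has_real_derivative
      F * (4 * (real m)\<^sup>2 * q t ^ m - 2 * m * (2 * m + 1) * q t ^ Suc m)) (at t)" for t F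
  proof -
    have *: "- 2 * F * real m * (q t) * q t ^ m + - 2 * F * real m * tanh t * (- 2 * real m * tanh t * q t ^ m)
        = F * (4 * (real m)\<^sup>2 * q t ^ m - 2 * m * (2 * m + 1) * q t ^ Suc m)"
    proof -
      have *: "(tanh t)\<^sup>2 = 1 - q t" by (simp add: q_def)
      have "- 2 * F * real m * (q t) * q t ^ m + - 2 * F * real m * tanh t * (- 2 * real m * tanh t * q t ^ m)
          = F * (4 * (real m)\<^sup>2 * (tanh t)\<^sup>2 * q t ^ m - 2 * m * q t ^ Suc m)"
        by (simp add: algebra_simps power2_eq_square)
      then show ?thesis unfolding * by (simp add: algebra_simps power2_eq_square)
    qed
    have "((\<lambda>t. - 2 * F * real m * tanh t) has_real_derivative - 2 * F * real m * q t) (at t)"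
      unfolding q_def by (auto intro!: derivative_eq_intros)
    from DERIV_mult[OF this, of "\<lambda>t. q t ^ m" "- 2 * real m * tanh t * q t ^ m"] D1[of 1 t]
    show ?thesis by (simp only: * [symmetric]) (simp add: algebra_simps)
  qed
  have IH: "dop (lin_prod (gjms_factors m)) q = (\<lambda>t. fact (2 * m - 1) * q t ^ m)"
    using step.IH by (simp only: q_def)
  have "dop (lin_prod (gjms_factors (Suc m))) q t = fact (2 * Suc m - 1) * q t ^ Suc m" for t
  proof -
    have "dop (lin_prod (gjms_factors (Suc m))) q t
        = dop [:4 * (real m)\<^sup>2, 0, -1:] (\<lambda>t. fact (2 * m - 1) * q t ^ m) t"
      by (simp only: lin_prod_gjms_Suc[OF step(1)] dop_mult[OF tq] IH)
    also have "\<dots> = 2 * real m * (2 * real m + 1) * fact (2 * m - 1) * q t ^ Suc m"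
      by (simp only: dop_pCons deriv_eqI[OF D1] deriv_eqI[OF D2]) (simp add: algebra_simps)
    also have "2 * real m * (2 * real m + 1) * fact (2 * m - 1) = fact (2 * Suc m - 1)"
      by (simp add: k algebra_simps)
    finally show ?thesis .
  qed
  then have "dop (lin_prod (gjms_factors (Suc m))) q = (\<lambda>t. fact (2 * Suc m - 1) * q t ^ Suc m)"
    by (rule ext)
  then show ?case unfolding q_def .
qed

lemma one_minus_tanh_sq: "1 - (tanh t)\<^sup>2 = 1 / (cosh (t::real))\<^sup>2"
proof -
  have "tanh t * cosh t = sinh t" by (simp add: tanh_def)
  then have "(1 - (tanh t)\<^sup>2) * (cosh t)\<^sup>2 = (cosh t)\<^sup>2 - (sinh t)\<^sup>2"
    by (metis left_diff_distrib mult_1 power_mult_distrib)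
  then show ?thesis
    by (subst eq_divide_eq) (simp only: hyperbolic_pythagoras, simp)
qed

text \<open>For u = ln (2 / (1 + r^2)) one has t + u = - ln (cosh t), whence p = 1 + tanh t; the
  limits 0 and 2 of p give those of \<open>dop L p\<close>.\<close>

lemma sphere_profile:
  fixes m :: nat
  assumes "m \<ge> 1"
  defines "L \<equiv> lin_prod (gjms_factors m)" and "p \<equiv> \<lambda>t::real. 1 + tanh t"
  shows "tame p" "(dop L p \<longlongrightarrow> 0) at_bot" "(dop L p \<longlongrightarrow> 2 * coeff L 0) at_top"
    and "deriv (dop L p) t = fact (2 * m - 1) * exp (real (2 * m) * - ln (cosh t))"
proof -
  have p: "p = (\<lambda>t. poly [:1, 1:] (tanh t))" by (simp add: p_def)
  show tp: "tame p" unfolding p by (rule tame_poly_tanh)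
  show "(dop L p \<longlongrightarrow> 0) at_bot"
    using dop_poly_tanh_tendsto[OF tanh_real_at_bot, of L "[:1, 1:]"] by (simp add: p)
  show "(dop L p \<longlongrightarrow> 2 * coeff L 0) at_top"
    using dop_poly_tanh_tendsto[OF tanh_real_at_top, of L "[:1, 1:]"] by (simp add: p mult.commute)
  have "deriv p = (\<lambda>t. 1 - (tanh t)\<^sup>2)"
    unfolding p_def by (intro deriv_eqI) (auto intro!: derivative_eq_intros)
  then have "deriv (dop L p) t = fact (2 * m - 1) * (1 - (tanh t)\<^sup>2) ^ m"
    using dop_gjms_sech[OF assms(1)] by (simp add: deriv_dop[OF tp] L_def)
  moreover have "exp (real (2 * m) * - ln (cosh t)) = (1 / (cosh t)\<^sup>2) ^ m"
  proof -
    have "exp (real (2 * m) * - ln (cosh t)) = exp (- ln (cosh t)) ^ (2 * m)"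
      by (rule exp_of_nat_mult)
    also have "\<dots> = (1 / (cosh t)\<^sup>2) ^ m"
      by (simp add: exp_minus power_mult power_one_over inverse_eq_divide)
    finally show ?thesis .
  qed
  ultimately show "deriv (dop L p) t = fact (2 * m - 1) * exp (real (2 * m) * - ln (cosh t))"
    by (simp add: one_minus_tanh_sq)
qed

text \<open>These are the growth barriers that the sliding argument asks of the reference profile,
  with B = ln 2.\<close>

lemma ln_cosh_bounds: "- \<bar>t\<bar> \<le> - ln (cosh t)" "- ln (cosh t) \<le> - \<bar>t\<bar> + ln 2" for t :: real
proof -
  define E F where "E = exp \<bar>t\<bar>" and "F = exp (- \<bar>t\<bar>)"
  have c: "cosh t = (E + F) / 2"
    using cosh_real_abs[of t] unfolding E_def F_def by (simp only: cosh_field_def)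
  have EF: "F \<le> E" "F > 0" "E > 0" unfolding E_def F_def by simp_all
  have ln_E: "ln E = \<bar>t\<bar>" by (simp add: E_def)
  have "ln (cosh t) \<le> ln E" unfolding c by (rule ln_mono) (use EF in auto)
  then show "- \<bar>t\<bar> \<le> - ln (cosh t)" unfolding ln_E by simp
  have "ln (E / 2) \<le> ln (cosh t)" unfolding c by (rule ln_mono) (use EF in auto)
  then show "- ln (cosh t) \<le> - \<bar>t\<bar> + ln 2" using EF ln_E by (simp add: ln_div)
qed

lemma DERIV_ln_cosh: "((\<lambda>t::real. - ln (cosh t)) has_real_derivative 1 - (1 + tanh t)) (at t)"
proof -
  have "((\<lambda>t. ln (cosh t)) has_real_derivative inverse (cosh t) * sinh t) (at t)"
    by (rule DERIV_chain2[OF DERIV_ln]) (auto intro!: derivative_eq_intros)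
  from DERIV_minus[OF this] show ?thesis
    by (simp add: tanh_def divide_inverse mult.commute)
qed

text \<open>The cancellation in the sphere volume formula, stated for abstract reals so that
  simplification leaves factorials and powers alone: x = m, y = m + 1, z = 2 m + 1, A = 4^(m - 1), B
  = (m - 1)!, C = (2 m - 1)!, P = pi^m.\<close>

lemma sphere_volume_even_aux:
  fixes x y z A B C P :: real
  assumes nz: "x \<noteq> 0" "y \<noteq> 0" "z \<noteq> 0" "B \<noteq> 0" "C \<noteq> 0"
  shows "z * (16 * A * (y * (x * B)) / (2 * y * (z * (2 * x * C))) * P)
    = 2 * x * (P / (x * B)) * (2 * (A * B\<^sup>2) / C)"
proof -
  have "16 * A * (y * (x * B)) / (2 * y * (z * (2 * x * C))) = 4 * A * B / (z * C)"
    using nz by (subst frac_eq_eq) (auto intro: nz)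
  moreover have "2 * x * (P / (x * B)) = 2 * P / B" using nz by (subst times_divide_eq_right, subst frac_eq_eq) auto
  moreover have "z * (4 * A * B / (z * C) * P) = 4 * A * B * P / C" 
    using nz by (simp only: times_divide_eq_right times_divide_eq_left, subst frac_eq_eq) auto
  moreover have "2 * P / B * (2 * (A * B\<^sup>2) / C) =  4 * A * B * P / C"
    using nz by (simp only: times_divide_times_eq, subst frac_eq_eq) (auto simp: power2_eq_square)
  ultimately show ?thesis by (simp only:)
qed

text \<open>The last factor is 2 L(0) / (n - 1)!. In this form (n - 1)! |S^n| is visibly n times the
  unit ball volume times the limit 2 L(0) of the round P.\<close>

lemma sphere_volume_even:
  assumes "CARD('n::finite) = 2 * m" "m \<ge> 1"
  shows "sphere_volume TYPE('n) =
    real (2 * m) * unit_ball_vol (real (2 * m)) * (2 * (4 ^ (m - 1) * (fact (m - 1))\<^sup>2) / fact (2 * m - 1))"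
proof -
  obtain k where k: "m = Suc k" using assms(2) by (cases m) auto
  define x where "x = (real CARD('n) + 1) / 2"
  have "x \<noteq> 0" "x \<notin> \<int>\<^sub>\<le>\<^sub>0" by (auto simp: x_def dest: nonpos_Ints_nonpos)
  then have "2 * pi powr x / Gamma x = 2 * x * (pi powr x / Gamma (x + 1))"
    by (simp add: Gamma_plus1 Gamma_eq_zero_iff)
  then have "sphere_volume TYPE('n) = (real CARD('n) + 1) * unit_ball_vol (real CARD('n) + 1)"
    by (simp add: sphere_volume_eq unit_ball_vol_def flip: x_def) (simp add: x_def)
  also have "\<dots> = real (2 * m + 1) * unit_ball_vol (real (2 * m + 1))"
    by (simp add: assms add.commute)
  also have "\<dots> = real (2 * m + 1) * (2 ^ (2 * Suc m) * fact (Suc m) / fact (2 * Suc m) * pi ^ m)"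
    by (simp only: unit_ball_vol_odd)
  also have "\<dots> = real (2 * m) * (pi ^ m / fact m) * (2 * (4 ^ (m - 1) * (fact (m - 1))\<^sup>2) / fact (2 * m - 1))"
  proof -
    have "fact (2 * Suc m) = 2 * real (Suc m) * (real (2 * m + 1) * (2 * real m * fact (2 * m - 1)))"
      unfolding k by (simp add: algebra_simps)
    moreover have "fact (Suc m) = real (Suc m) * (real m * fact (m - 1))" unfolding k by simp
    moreover have "(2::real) ^ (2 * Suc m) = 16 * 4 ^ (m - 1)" unfolding k by (simp add: power_mult)
    moreover have "fact m = real m * fact (m - 1)" unfolding k by simp
    ultimately show ?thesis
      using sphere_volume_even_aux[of "real m" "real (Suc m)" "real (2 * m + 1)" "fact (m - 1)"
          "fact (2 * m - 1)" "4 ^ (m - 1)" "pi ^ m"] assms(2)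
      by simp
  qed
  finally show ?thesis by (simp only: unit_ball_vol_even)
qed

section \<open>Radial functions along a ray\<close>

lemma smooth_differentiable: "smooth f \<Longrightarrow> f differentiable (at x)"
  unfolding smooth_def by (metis C_k.simps(2))

lemma smooth_partial: "smooth f \<Longrightarrow> smooth (partial_deriv i f)"
  unfolding smooth_def by (metis C_k.simps(2))

lemma smooth_continuous: "smooth f \<Longrightarrow> continuous_on UNIV f"
  unfolding smooth_def by (metis C_k.simps(1))

lemma smooth_has_derivative: "smooth f \<Longrightarrow> (f has_derivative frechet_derivative f (at x)) (at x)"
  using smooth_differentiable frechet_derivative_works by blast

lemma partial_deriv_eqI: "(f has_derivative f') (at x) \<Longrightarrow> partial_deriv i f x = f' (axis i 1)"
  unfolding partial_deriv_def by (metis frechet_derivative_at)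

lemma partial_deriv_lincomb:
  assumes "f differentiable (at x)" "g differentiable (at x)"
  shows "partial_deriv i (\<lambda>x. a * f x + b * g x) x = a * partial_deriv i f x + b * partial_deriv i g x"
proof -
  note [derivative_intros] = assms[THEN frechet_derivative_works[THEN iffD1]]
  show ?thesis
    unfolding partial_deriv_def[of i f] partial_deriv_def[of i g]
    by (rule partial_deriv_eqI) (auto intro!: derivative_eq_intros)
qed

lemma C_k_lincomb: "C_k k f \<Longrightarrow> C_k k g \<Longrightarrow> C_k k (\<lambda>x. a * f x + b * g x)"
proof (induction k arbitrary: f g)
  case 0
  then show ?case by (auto intro!: continuous_intros)
next
  case (Suc k)
  then have "partial_deriv i (\<lambda>x. a * f x + b * g x) = (\<lambda>x. a * partial_deriv i f x + b * partial_deriv i g x)" for i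
    by (intro ext partial_deriv_lincomb) auto
  then show ?case using Suc by (auto intro!: derivative_intros)
qed

lemma smooth_lincomb: "smooth f \<Longrightarrow> smooth g \<Longrightarrow> smooth (\<lambda>x. a * f x + b * g x)"
  by (simp add: smooth_def C_k_lincomb)

lemma C_k_zero: "C_k k (\<lambda>x. 0)"
proof (induction k)
  case (Suc k)
  have "partial_deriv i (\<lambda>x::real^'a. 0) = (\<lambda>x. 0)" for i
    by (intro ext partial_deriv_eqI) (rule has_derivative_const)
  then show ?case using Suc by simp
qed simp

lemma smooth_sum:
  assumes "finite I" "\<And>i. i \<in> I \<Longrightarrow> smooth (f i)"
  shows "smooth (\<lambda>x. \<Sum>i\<in>I. f i x)"
  using assms
proof (induction I rule: finite_induct)
  case (insert i I)
  then show ?case using smooth_lincomb[of "f i" "\<lambda>x. \<Sum>i\<in>I. f i x" 1 1] by simp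
qed (simp add: smooth_def C_k_zero)

lemma smooth_neg_laplacian:
  assumes "smooth f"
  shows "smooth (neg_laplacian f)"
proof -
  have "smooth (laplacian f)"
    unfolding laplacian_def[abs_def] by (intro smooth_sum smooth_partial assms) auto
  then show ?thesis
    using smooth_lincomb[of "laplacian f" "laplacian f" "-1" 0] by (simp add: neg_laplacian_def[abs_def])
qed

text \<open>The index \<^term>\<open>undefined\<close> is only an arbitrary coordinate direction.\<close>

definition ray :: "(real ^ 'n::finite \<Rightarrow> real) \<Rightarrow> real \<Rightarrow> real" where
  "ray g t = g (exp t *\<^sub>R axis undefined 1)"

lemma DERIV_ray:
  assumes "smooth g"
  shows "(ray g has_real_derivative exp t * ray (partial_deriv undefined g) t) (at t)"
proof -
  let ?e = "axis undefined 1 :: real ^ 'n"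
  interpret bounded_linear "frechet_derivative g (at (exp t *\<^sub>R ?e))"
    using smooth_has_derivative[OF assms] by (rule has_derivative_bounded_linear)
  have "((\<lambda>t. exp t *\<^sub>R ?e) has_derivative (\<lambda>h. (h * exp t) *\<^sub>R ?e)) (at t)"
    by (auto intro!: derivative_eq_intros)
  from has_derivative_compose[OF this smooth_has_derivative[OF assms]]
  have "(ray g has_derivative (\<lambda>h. (h * exp t) * partial_deriv undefined g (exp t *\<^sub>R ?e))) (at t)"
    by (simp add: scaleR ray_def[abs_def] partial_deriv_def)
  then show ?thesis
    unfolding has_field_derivative_def by (rule has_derivative_eq_rhs) (simp add: ray_def fun_eq_iff)
qed

lemma ray_at_bot: 
  assumes "smooth g"
  shows "(ray g \<longlongrightarrow> g 0) at_bot"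
proof -
  have "((\<lambda>t. exp t *\<^sub>R (axis undefined 1 :: real ^ 'n)) \<longlongrightarrow> 0 *\<^sub>R axis undefined 1) at_bot"
    by (intro tendsto_scaleR exp_at_bot tendsto_const)
  moreover have "isCont g 0" 
    using smooth_continuous[OF assms] by (simp add: continuous_on_eq_continuous_at)
  ultimately show ?thesis
    unfolding ray_def[abs_def] by (intro isCont_tendsto_compose[of 0 g]) simp_all
qed

text \<open>The terms exp (k t) \<open>ray g\<close> span a class closed under D, because D
  (\<open>ray g\<close>) is exp t times the ray of a partial derivative of g. The bound k \<ge> j
  records the order of vanishing at the origin: for j \<ge> 1 every member tends to 0 at
  -\<infinity>.\<close>

inductive ray_span :: "nat \<Rightarrow> 'n::finite itself \<Rightarrow> (real \<Rightarrow> real) \<Rightarrow> bool" for j n where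
  base: "smooth (g :: real ^ 'n \<Rightarrow> real) \<Longrightarrow> k \<ge> j \<Longrightarrow> ray_span j n (\<lambda>t. exp (real k * t) * ray g t)"
| add: "ray_span j n y \<Longrightarrow> ray_span j n z \<Longrightarrow> ray_span j n (\<lambda>t. y t + z t)"

lemma ray_span_scale: "ray_span j n y \<Longrightarrow> ray_span j n (\<lambda>t. a * y t)"
proof (induction rule: ray_span.induct)
  case (base g k)
  then have "smooth (\<lambda>x. a * g x)" using smooth_lincomb[of g g a 0] by simp
  then have "ray_span j n (\<lambda>t. exp (real k * t) * ray (\<lambda>x. a * g x) t)" using base(2) by (rule ray_span.base)
  then show ?case by (simp add: ray_def mult.left_commute)
next
  case (add y z)
  then show ?case using ray_span.add by (simp add: distrib_left)
qed

lemma ray_span_at_bot: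
  "ray_span j n y \<Longrightarrow> \<exists>l. (y \<longlongrightarrow> l) at_bot \<and> (j \<ge> 1 \<longrightarrow> l = 0)"
proof (induction rule: ray_span.induct)
  case (base g k)
  show ?case
  proof (cases "k = 0")
    case True
    then show ?thesis using base ray_at_bot[OF base(1)] by auto
  next
    case False
    then have "((\<lambda>t. exp (real k * t)) \<longlongrightarrow> 0) at_bot" by real_asymp
    from tendsto_mult[OF this ray_at_bot[OF base(1)]] show ?thesis by auto
  qed
next
  case (add y z)
  then obtain l l' where "(y \<longlongrightarrow> l) at_bot" "(z \<longlongrightarrow> l') at_bot" "j \<ge> 1 \<longrightarrow> l = 0" "j \<ge> 1 \<longrightarrow> l' = 0" by blast
  then show ?case by (intro exI[of _ "l + l'"]) (auto intro: tendsto_add)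
qed

lemma ray_span_deriv:
  "ray_span j n y \<Longrightarrow> \<exists>y'. ray_span j n y' \<and> (\<forall>t. (y has_real_derivative y' t) (at t))"
proof (induction rule: ray_span.induct)
  case (base g k)
  let ?y' = "\<lambda>t. real k * (exp (real k * t) * ray g t) + exp (real (Suc k) * t) * ray (partial_deriv undefined g) t"
  have "ray_span j n ?y'"
    by (intro ray_span.add ray_span_scale ray_span.base base smooth_partial) (use base in auto)
  moreover have "((\<lambda>t. exp (real k * t) * ray g t) has_real_derivative ?y' t) (at t)" for t
    by (auto intro!: derivative_eq_intros DERIV_ray base simp: algebra_simps exp_add)
  ultimately show ?case by blast
next
  case (add y z)
  then obtain y' z' where "ray_span j n y'" "ray_span j n z'"
    "\<And>t. (y has_real_derivative y' t) (at t)" "\<And>t. (z has_real_derivative z' t) (at t)" by blast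
  then show ?case
    by (intro exI[of _ "\<lambda>t. y' t + z' t"]) (auto intro: ray_span.add DERIV_add)
qed

lemma ray_span_tame: "ray_span j n y \<Longrightarrow> tame y"
proof (rule tame_coinduct[where \<Phi> = "ray_span j n"])
  fix y assume y: "ray_span j n y"
  then obtain y' where y': "ray_span j n y'" "\<And>t. (y has_real_derivative y' t) (at t)"
    using ray_span_deriv by blast
  have "continuous_on S y" for S
    using DERIV_continuous_on[OF has_field_derivative_at_within[OF y'(2)]] .
  then have "bounded (y ` {..T})" for T
    using ray_span_at_bot[OF y] bounded_image_atMost by blast
  then show "\<exists>y'. ray_span j n y' \<and> (\<forall>t. (y has_real_derivative y' t) (at t)) \<and> (\<forall>T. bounded (y ` {..T}))"
    using y' by blast
qed

lemma ray_span_zero: "ray_span j n (\<lambda>t. 0)"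
  using ray_span.base[of "\<lambda>x. 0" j j] by (simp add: smooth_def C_k_zero ray_def)

lemma ray_span_dop: "ray_span j n y \<Longrightarrow> ray_span j n (dop q y)"
proof (induction q arbitrary: y)
  case (pCons a q)
  obtain y' where y': "ray_span j n y'" "\<And>t. (y has_real_derivative y' t) (at t)"
    using ray_span_deriv[OF pCons(3)] by blast
  have "deriv y = y'" using y'(2) by (rule deriv_eqI)
  then have "dop (pCons a q) y = (\<lambda>t. a * y t + dop q y' t)"
    by (intro ext) (simp only: dop_pCons)
  then show ?case
    using ray_span.add[OF ray_span_scale[OF pCons(3)] pCons(2)[OF y'(1)]] by simp
qed (simp add: ray_span_zero)

lemma ray_span_ray:
  assumes "smooth (g :: real ^ 'n::finite \<Rightarrow> real)"
  shows "ray_span 0 TYPE('n) (ray g)" "ray_span 1 TYPE('n) (deriv (ray g))"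
proof -
  show "ray_span 0 TYPE('n) (ray g)"
    using ray_span.base[OF assms, of 0 0] by simp
  have "deriv (ray g) = (\<lambda>t. exp (real 1 * t) * ray (partial_deriv undefined g) t)"
    using deriv_eqI[OF DERIV_ray[OF assms]] by simp
  then show "ray_span 1 TYPE('n) (deriv (ray g))"
    using ray_span.base[where n = "TYPE('n)" and j = 1 and k = 1, OF smooth_partial[OF assms]] by simp
qed

section \<open>Gradient and Laplacian of radial functions in logarithmic radius\<close>

lemma radial_eq_ray:
  assumes "radially_symmetric g" "x \<noteq> 0"
  shows "g x = ray g (ln (norm x))"
proof -
  have "norm x = norm (exp (ln (norm x)) *\<^sub>R (axis undefined 1 :: real ^ 'a))"
    using assms(2) by (simp add: norm_axis_1)
  then show ?thesis using assms(1) unfolding radially_symmetric_def ray_def by blast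
qed

lemma has_derivative_ln_norm:
  fixes x :: "real ^ 'n::finite"
  assumes \<phi>: "(\<phi> has_real_derivative \<phi>') (at (ln (norm x)))" and x: "x \<noteq> 0"
  shows "((\<lambda>z. \<phi> (ln (norm z))) has_derivative (\<lambda>h. \<phi>' * (h \<bullet> x) / (norm x)\<^sup>2)) (at x)"
proof -
  have "((\<lambda>z. ln (norm z)) has_derivative (\<lambda>h. h \<bullet> sgn x / norm x)) (at x)"
    using x by (auto intro!: derivative_eq_intros has_derivative_norm simp: divide_inverse)
  from has_derivative_compose[OF this \<phi>[unfolded has_field_derivative_def]]
  show ?thesis by (simp add: sgn_div_norm power2_eq_square divide_inverse mult_ac)
qed

lemma eventually_radial_eq_ray:
  assumes "radially_symmetric g" "x \<noteq> 0"
  shows "eventually (\<lambda>z. g z = ray g (ln (norm z))) (nhds x)"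
proof -
  have "eventually (\<lambda>z. z \<noteq> 0) (nhds x)" using assms(2) by (rule t1_space_nhds)
  then show ?thesis by eventually_elim (rule radial_eq_ray[OF assms(1)])
qed

lemma partial_deriv_radial:
  fixes x :: "real ^ 'n::finite"
  assumes "smooth g" "radially_symmetric g" "x \<noteq> 0"
  shows "partial_deriv i g x = deriv (ray g) (ln (norm x)) * x $ i / (norm x)\<^sup>2"
proof -
  have "(ray g has_real_derivative deriv (ray g) (ln (norm x))) (at (ln (norm x)))"
    using ray_span_tame[OF ray_span_ray(1)[OF assms(1)]] by (rule tame_DERIV)
  from has_derivative_ln_norm[OF this assms(3)]
  have "(g has_derivative (\<lambda>h. deriv (ray g) (ln (norm x)) * (h \<bullet> x) / (norm x)\<^sup>2)) (at x)"
    by (rule has_derivative_transform_eventually)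
      (use eventually_radial_eq_ray[OF assms(2,3)] assms in
        \<open>auto simp: radial_eq_ray eventually_at_filter elim: eventually_mono\<close>)
  then show ?thesis by (simp add: partial_deriv_eqI inner_axis')
qed

lemma sum_sq_components: "(\<Sum>i\<in>UNIV. (x $ i)\<^sup>2) = (norm (x :: real ^ 'n::finite))\<^sup>2"
  unfolding power2_norm_eq_inner inner_vec_def by (simp add: power2_eq_square)

lemma grad_radial:
  fixes x :: "real ^ 'n::finite"
  assumes "smooth g" "radially_symmetric g" "x \<noteq> 0"
  shows "(norm (grad g x))\<^sup>2 = (deriv (ray g) (ln (norm x)))\<^sup>2 / (norm x)\<^sup>2"
proof -
  have "(norm (grad g x))\<^sup>2 = (\<Sum>i\<in>UNIV. (grad g x $ i)\<^sup>2)"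
    by (simp only: sum_sq_components)
  also have "\<dots> = (\<Sum>i\<in>UNIV. (deriv (ray g) (ln (norm x)) / (norm x)\<^sup>2)\<^sup>2 * (x $ i)\<^sup>2)"
    by (intro sum.cong) (auto simp: grad_def partial_deriv_radial[OF assms] power_divide power_mult_distrib)
  also have "\<dots> = (deriv (ray g) (ln (norm x)) / (norm x)\<^sup>2)\<^sup>2 * (norm x)\<^sup>2"
    by (simp only: sum_distrib_left[symmetric] sum_sq_components)
  finally show ?thesis using assms(3) by (simp add: power2_eq_square)
qed

lemma laplacian_radial:
  fixes x :: "real ^ 'n::finite"
  assumes g: "smooth g" "radially_symmetric g" and x: "x \<noteq> 0"
  defines "G \<equiv> ray g" and "s \<equiv> ln (norm x)"
  shows "laplacian g x = (deriv (deriv G) s + (real CARD('n) - 2) * deriv G s) / (norm x)\<^sup>2"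
proof -
  \<comment> \<open>\<open>\<psi>\<close> absorbs the factor 1 / |x|^2, so that the i-th partial
    derivative of g is x_i times \<open>\<psi>\<close> of ln |x|, ready for the product
    rule.\<close>
  define \<psi> where "\<psi> = (\<lambda>s. deriv G s * exp (- 2 * s))"
  have tG: "tame G" unfolding G_def by (rule ray_span_tame[OF ray_span_ray(1)[OF g(1)]])
  have \<psi>: "(\<psi> has_real_derivative (deriv (deriv G) s - 2 * deriv G s) * exp (- 2 * s)) (at s)" for s
    unfolding \<psi>_def using tame_DERIV[OF tame_deriv[OF tG], of s]
    by (auto intro!: derivative_eq_intros simp: algebra_simps)
  have en: "exp (- 2 * ln (norm z)) = 1 / (norm z)\<^sup>2" if "z \<noteq> 0" for z :: "real ^ 'n"
  proof -
    have "exp (2 * ln (norm z)) = (norm z)\<^sup>2"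
      using that by (simp add: exp_double)
    then show ?thesis by (simp add: exp_minus inverse_eq_divide)
  qed
  have p: "partial_deriv i g z = z $ i * \<psi> (ln (norm z))" if "z \<noteq> 0" for i z
    by (simp only: partial_deriv_radial[OF g that] \<psi>_def G_def en[OF that]) simp
  define d where "d = (deriv (deriv G) s - 2 * deriv G s) * exp (- 2 * s)"
  have pp: "partial_deriv i (partial_deriv i g) x = \<psi> s + d / (norm x)\<^sup>2 * (x $ i)\<^sup>2" for i
  proof -
    have "((\<lambda>z. \<psi> (ln (norm z))) has_derivative (\<lambda>h. d * (h \<bullet> x) / (norm x)\<^sup>2)) (at x)"
      using has_derivative_ln_norm[OF \<psi> x] by (simp add: d_def s_def)
    moreover have "((\<lambda>z. z $ i) has_derivative (\<lambda>h. h $ i)) (at x)"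
      by (rule bounded_linear.has_derivative[OF bounded_linear_vec_nth has_derivative_ident])
    ultimately have "((\<lambda>z. z $ i * \<psi> (ln (norm z))) has_derivative
        (\<lambda>h. x $ i * (d * (h \<bullet> x) / (norm x)\<^sup>2) + h $ i * \<psi> (ln (norm x)))) (at x)"
      by (rule has_derivative_mult[rotated])
    moreover have "eventually (\<lambda>z. z $ i * \<psi> (ln (norm z)) = partial_deriv i g z) (at x)"
    proof -
      have "eventually (\<lambda>z. z \<noteq> 0) (at x)"
        using t1_space_nhds[OF x] by (auto simp: eventually_at_filter elim: eventually_mono)
      then show ?thesis by eventually_elim (simp add: p)
    qed
    ultimately have "(partial_deriv i g has_derivative
        (\<lambda>h. x $ i * (d * (h \<bullet> x) / (norm x)\<^sup>2) + h $ i * \<psi> (ln (norm x)))) (at x)"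
      by (rule has_derivative_transform_eventually) (simp_all add: p x)
    then show ?thesis
      by (simp add: partial_deriv_eqI inner_axis' s_def power2_eq_square)
  qed
  have "laplacian g x = real CARD('n) * \<psi> s + d / (norm x)\<^sup>2 * (norm x)\<^sup>2"
    by (simp only: laplacian_def pp sum.distrib sum_distrib_left[symmetric] sum_sq_components) simp
  also have "\<dots> = (deriv (deriv G) s + (real CARD('n) - 2) * deriv G s) * exp (- 2 * s)"
  proof -
    have "d / (norm x)\<^sup>2 * (norm x)\<^sup>2 = d" using x by simp
    then show ?thesis by (simp only: d_def \<psi>_def) (simp add: algebra_simps)
  qed
  finally show ?thesis by (simp only: s_def en[OF x]) simp
qed

lemma radially_symmetric_neg_laplacian:
  assumes "smooth g" "radially_symmetric g"
  shows "radially_symmetric (neg_laplacian g)"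
  unfolding radially_symmetric_def
proof (intro allI impI)
  fix x y :: "real ^ 'a" assume *: "norm x = norm y"
  show "neg_laplacian g x = neg_laplacian g y"
  proof (cases "x = 0")
    case False
    then have "y \<noteq> 0" using * by auto
    then show ?thesis using False * by (simp add: neg_laplacian_def laplacian_radial[OF assms])
  qed (use * in simp)
qed

lemma ray_neg_laplacian:
  assumes "smooth (g :: real ^ 'n::finite \<Rightarrow> real)" "radially_symmetric g"
  shows "exp (2 * t) * ray (neg_laplacian g) t
    = - (deriv (deriv (ray g)) t + (real CARD('n) - 2) * deriv (ray g) t)"
proof -
  have "(exp t)\<^sup>2 = exp (2 * t)" by (simp add: power2_eq_square flip: exp_add)
  then show ?thesis
    by (simp add: ray_def[of "neg_laplacian g"] neg_laplacian_def laplacian_radial[OF assms] norm_axis_1)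
qed

section \<open>Integration in the logarithmic radius\<close>

text \<open>With the minus sign, upper half-lines pull back to balls about 0. These have finite
  volume, so the measure on the line is determined by its upper tails.\<close>

lemma distr_minus_ln_norm:
  defines "N \<equiv> CARD('n)"
  shows "distr lborel borel (\<lambda>x::real^'n::finite. - ln (norm x))
    = density lborel (\<lambda>s. ennreal (real N * unit_ball_vol (real N) * exp (- real N * s)))"
    (is "?M = density lborel (\<lambda>s. ennreal (?d s))")
proof (rule measure_eqI_lessThan)
  have N: "N > 0" by (simp add: N_def)
  have M: "emeasure ?M {a<..} = ennreal (unit_ball_vol (real N) * exp (- real N * a))" for a
  proof -
    have "emeasure ?M {a<..} = emeasure lborel ((\<lambda>x::real^'n. - ln (norm x)) -` {a<..} \<inter> space lborel)"
      by (rule emeasure_distr) auto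
    also have "\<dots> = emeasure lborel (ball (0::real^'n) (exp (- a)))"
    proof (rule emeasure_eq_AE)
      \<comment> \<open>Only the origin, where the logarithm is a default value, can be misplaced;
        it is a null set.\<close>
      have "AE x in lborel. (x::real^'n) \<noteq> 0" by (rule AE_lborel_singleton)
      then show "AE x in lborel. x \<in> (\<lambda>x::real^'n. - ln (norm x)) -` {a<..} \<inter> space lborel
          \<longleftrightarrow> x \<in> ball 0 (exp (- a))"
      proof eventually_elim
        case (elim x)
        then have "ln (norm x) < - a \<longleftrightarrow> norm x < exp (- a)"
          by (metis exp_less_cancel_iff exp_ln zero_less_norm_iff)
        then show ?case by (auto simp: minus_less_iff)
      qed
    qed (auto intro!: measurable_sets_borel[of _ borel])
    also have "\<dots> = ennreal (unit_ball_vol (real N) * exp (- a) ^ N)"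
      by (subst emeasure_ball) (simp_all add: N_def)
    also have "exp (- a) ^ N = exp (- real N * a)" using exp_of_nat_mult[of N "- a"] by simp
    finally show ?thesis .
  qed
  have D: "emeasure (density lborel (\<lambda>s. ennreal (?d s))) {a<..}
      = ennreal (unit_ball_vol (real N) * exp (- real N * a))" for a
  proof -
    have "emeasure (density lborel (\<lambda>s. ennreal (?d s))) {a<..}
        = (\<integral>\<^sup>+s. ennreal (?d s) * indicator {a<..} s \<partial>lborel)"
      by (rule emeasure_density) auto
    also have "\<dots> = (\<integral>\<^sup>+s. ennreal (?d s) * indicator {a..} s \<partial>lborel)"
    proof (rule nn_integral_cong_AE)
      have "AE s in lborel. s \<noteq> a" by (rule AE_lborel_singleton)
      then show "AE s in lborel. ennreal (?d s) * indicator {a<..} s = ennreal (?d s) * indicator {a..} s"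
        by eventually_elim (auto split: split_indicator)
    qed
    also have "\<dots> = ennreal (0 - (- unit_ball_vol (real N) * exp (- real N * a)))"
    proof (rule nn_integral_FTC_atLeast)
      show "((\<lambda>s. - unit_ball_vol (real N) * exp (- real N * s)) has_real_derivative ?d x) (at x)" for x
        by (auto intro!: derivative_eq_intros)
      have "((\<lambda>s. exp (- real N * s)) \<longlongrightarrow> 0) at_top" using N by real_asymp
      from tendsto_mult[OF tendsto_const[of "- unit_ball_vol (real N)"] this]
      show "((\<lambda>s. - unit_ball_vol (real N) * exp (- real N * s)) \<longlongrightarrow> 0) at_top" by simp
    qed auto
    finally show ?thesis by simp
  qed
  show "emeasure ?M {a<..} < \<infinity>" for a unfolding M by simp
  show "emeasure ?M {a<..} = emeasure (density lborel (\<lambda>s. ennreal (?d s))) {a<..}" for a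
    unfolding M D ..
qed auto

text \<open>Pushforward under - ln |x|, followed by the reflection s = - t that undoes the
  sign.\<close>

lemma radial_lebesgue_integral:
  fixes f :: "real ^ 'n::finite \<Rightarrow> real" and g :: "real \<Rightarrow> real"
  assumes f: "f \<in> borel_measurable borel" and g: "g \<in> borel_measurable borel"
    and fg: "\<And>x. x \<noteq> 0 \<Longrightarrow> f x = g (ln (norm x))"
  defines "N \<equiv> real CARD('n)"
  shows "integrable lebesgue f \<longleftrightarrow> integrable lborel (\<lambda>t. exp (N * t) * g t)"
    and "integral\<^sup>L lebesgue f = N * unit_ball_vol N * (\<integral>t. exp (N * t) * g t \<partial>lborel)"
proof -
  have N: "N > 0" by (simp add: N_def)
  have c: "N * unit_ball_vol N > 0" using N by simp
  let ?l = "\<lambda>x::real^'n. - ln (norm x)"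
  let ?d = "\<lambda>s. N * unit_ball_vol N * exp (- N * s)"
  have ml: "?l \<in> borel_measurable lborel" by auto
  have ae: "AE x in lborel. f x = g (- ?l x)"
    using AE_lborel_singleton[of "0 :: real^'n"] by eventually_elim (simp add: fg)
  have mg: "(\<lambda>s. g (- s)) \<in> borel_measurable borel" using g by measurable
  have mgl: "(\<lambda>x. g (- ?l x)) \<in> borel_measurable lborel"
    using measurable_compose[OF ml mg] by simp
  have D: "distr lborel borel ?l = density lborel (\<lambda>s. ennreal (?d s))"
    using distr_minus_ln_norm[where 'n='n] by (simp add: N_def)
  have dnn: "AE s in lborel. 0 \<le> ?d s" using c by (auto intro!: AE_I2 mult_nonneg_nonneg)
  have refl: "(\<lambda>s. ?d s *\<^sub>R g (- s)) = (\<lambda>s. (\<lambda>t. N * unit_ball_vol N * (exp (N * t) * g t)) (0 + (-1) * s))"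
    by (simp add: fun_eq_iff)
  have "integrable lebesgue f \<longleftrightarrow> integrable lborel f"
    using f by (intro integrable_completion) simp
  also have "\<dots> \<longleftrightarrow> integrable lborel (\<lambda>x. g (- ?l x))"
    using f mgl ae by (intro integrable_cong_AE) auto
  also have "\<dots> \<longleftrightarrow> integrable (distr lborel borel ?l) (\<lambda>s. g (- s))"
    using integrable_distr_eq[OF ml mg] by simp
  also have "\<dots> \<longleftrightarrow> integrable lborel (\<lambda>s. ?d s *\<^sub>R g (- s))"
    unfolding D using dnn mg by (intro integrable_density) auto
  also have "\<dots> \<longleftrightarrow> integrable lborel (\<lambda>t. N * unit_ball_vol N * (exp (N * t) * g t))"
    unfolding refl by (rule lborel_integrable_real_affine_iff) simp
  also have "\<dots> \<longleftrightarrow> integrable lborel (\<lambda>t. exp (N * t) * g t)"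
    using c by (subst integrable_mult_left_iff) auto
  finally show "integrable lebesgue f \<longleftrightarrow> integrable lborel (\<lambda>t. exp (N * t) * g t)" .
  have "integral\<^sup>L lebesgue f = integral\<^sup>L lborel f"
    using f by (intro integral_completion) simp
  also have "\<dots> = (\<integral>x. g (- ?l x) \<partial>lborel)"
    using f mgl ae by (intro integral_cong_AE) auto
  also have "\<dots> = integral\<^sup>L (distr lborel borel ?l) (\<lambda>s. g (- s))"
    using integral_distr[OF ml mg] by simp
  also have "\<dots> = (\<integral>s. ?d s *\<^sub>R g (- s) \<partial>lborel)"
    unfolding D using dnn mg by (intro integral_density) auto
  also have "\<dots> = (\<integral>t. N * unit_ball_vol N * (exp (N * t) * g t) \<partial>lborel)"
    unfolding refl by (subst (2) lborel_integral_real_affine[where c = "-1" and t = 0]) simp_all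
  finally show "integral\<^sup>L lebesgue f = N * unit_ball_vol N * (\<integral>t. exp (N * t) * g t \<partial>lborel)"
    by simp
qed

lemma lborel_FTC_nonneg:
  fixes P F :: "real \<Rightarrow> real"
  assumes der: "\<And>t. (P has_real_derivative F t) (at t)" and cont: "\<And>t. isCont F t"
    and nn: "\<And>t. F t \<ge> 0" and bot: "(P \<longlongrightarrow> a) at_bot" and top: "(P \<longlongrightarrow> b) at_top"
  shows "integrable lborel F" "integral\<^sup>L lborel F = b - a"
proof -
  have "set_integrable lborel (einterval (-\<infinity>) \<infinity>) F" "(LBINT t=-\<infinity>..\<infinity>. F t) = b - a"
    using interval_integral_FTC_nonneg[of "-\<infinity>" "\<infinity>" P F a b] der cont nn bot top
    by (simp_all add: ereal_tendsto_simps)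
  then show "integrable lborel F" "integral\<^sup>L lborel F = b - a"
    by (simp_all add: interval_lebesgue_integral_def set_integrable_def set_lebesgue_integral_def einterval_eq)
qed

text \<open>P is monotone, and the integral of F bounds its increase; this is where finite total
  Q-curvature yields the existence of P(\<infinity>).\<close>

lemma primitive_tendsto_at_top:
  fixes P F :: "real \<Rightarrow> real"
  assumes der: "\<And>t. (P has_real_derivative F t) (at t)" and cont: "\<And>t. isCont F t"
    and nn: "\<And>t. F t \<ge> 0" and int: "integrable lborel F"
  shows "\<exists>b. (P \<longlongrightarrow> b) at_top"
proof -
  have le: "P t \<le> P 0 + integral\<^sup>L lborel F" if "t \<ge> 0" for t
  proof -
    have "(\<integral>x. F x * indicator {0..t} x \<partial>lborel) = P t - P 0"
      by (rule integral_FTC_Icc_real) (use that der cont in auto)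
    moreover have "(\<integral>x. F x * indicator {0..t} x \<partial>lborel) \<le> integral\<^sup>L lborel F"
    proof (rule integral_mono)
      show "integrable lborel (\<lambda>x. F x * indicator {0..t} x)"
        by (intro integrable_real_mult_indicator int) auto
    qed (use nn int in \<open>auto simp: indicator_def\<close>)
    ultimately show ?thesis by simp
  qed
  have "P s \<le> P t" if "s \<le> t" for s t
    by (rule DERIV_nonneg_imp_nondecreasing[OF that]) (use der nn in blast)
  then have mono: "mono P" by (rule monoI)
  then have "incseq (\<lambda>n. P (real n))" by (auto simp: mono_def)
  moreover have "\<forall>n. P (real n) \<le> P 0 + integral\<^sup>L lborel F" using le by auto
  ultimately obtain b where "(\<lambda>n. P (real n)) \<longlonglongrightarrow> b"
    by (rule incseq_convergent)
  from tendsto_at_topI_sequentially_real[OF mono this] show ?thesis by blast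
qed

section \<open>Consequences of the scalar curvature inequality\<close>


lemma deriv_ge_imp_linear_growth:
  fixes f :: "real \<Rightarrow> real"
  assumes "\<And>t. (f has_real_derivative f' t) (at t)" and "\<And>t. t \<ge> T \<Longrightarrow> f' t \<ge> \<delta>" and "t \<ge> T"
  shows "f t \<ge> f T + \<delta> * (t - T)"
proof -
  have "f T - \<delta> * T \<le> f t - \<delta> * t"
  proof (rule DERIV_nonneg_imp_nondecreasing[OF assms(3)])
    fix x assume "T \<le> x"
    then show "\<exists>y. ((\<lambda>t. f t - \<delta> * t) has_real_derivative y) (at x) \<and> 0 \<le> y"
      using assms(1)[of x] assms(2)[of x] by (intro exI[of _ "f' x - \<delta>"]) (auto intro!: derivative_eq_intros)
  qed
  then show ?thesis by (simp add: algebra_simps)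
qed

text \<open>For p \<ge> 4 one has p (p - 2) \<ge> p^2 / 2, so - 1 / p would increase at least
  linearly while staying negative: blow-up in finite time. For p \<le> 0 the right-hand side is
  nonnegative, so p cannot decrease to -\<infinity>.\<close>

lemma riccati_not_diverges:
  fixes p :: "real \<Rightarrow> real"
  assumes der: "\<And>t. (p has_real_derivative p' t) (at t)" and \<kappa>: "\<kappa> > 0"
    and ev: "eventually (\<lambda>t. p' t \<ge> \<kappa> * p t * (p t - 2)) at_top"
  shows "\<not> diverges p"
proof
  assume "diverges p"
  then consider "filterlim p at_top at_top" | "filterlim p at_bot at_top" by (auto simp: diverges_def)
  then show False
  proof cases
    case 1
    then have "eventually (\<lambda>t. p t \<ge> 4) at_top" by (auto simp: filterlim_at_top)
    from eventually_conj[OF this ev] obtain T where T: "\<And>t. t \<ge> T \<Longrightarrow> p t \<ge> 4"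
        "\<And>t. t \<ge> T \<Longrightarrow> p' t \<ge> \<kappa> * p t * (p t - 2)"
      by (auto simp: eventually_at_top_linorder)
    define q where "q = (\<lambda>t. - 1 / p t)"
    have q': "q t \<ge> q T + \<kappa> / 2 * (t - T)" if "t \<ge> T" for t
    proof -
      have "q T - \<kappa> / 2 * T \<le> q t - \<kappa> / 2 * t"
      proof (rule DERIV_nonneg_imp_nondecreasing[OF that])
        fix x assume "T \<le> x"
        note x = T[OF this]
        have "\<kappa> / 2 * (p x)\<^sup>2 \<le> \<kappa> * p x * (p x - 2)"
        proof -
          have "\<kappa> * p x * (p x - 4) \<ge> 0" using \<kappa> x by simp
          then show ?thesis by (simp add: algebra_simps power2_eq_square)
        qed
        then have "\<kappa> / 2 \<le> p' x / (p x)\<^sup>2" using x by (subst pos_le_divide_eq) auto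
        moreover have "((\<lambda>t. q t - \<kappa> / 2 * t) has_real_derivative p' x / (p x)\<^sup>2 - \<kappa> / 2) (at x)"
          unfolding q_def using x der[of x]
          by (auto intro!: derivative_eq_intros simp: power2_eq_square)
        ultimately show "\<exists>y. ((\<lambda>t. q t - \<kappa> / 2 * t) has_real_derivative y) (at x) \<and> 0 \<le> y" by auto
      qed
      then show ?thesis by (simp add: algebra_simps diff_divide_distrib)
    qed
    have "filterlim (\<lambda>t. q T + \<kappa> / 2 * (t - T)) at_top at_top" using \<kappa> by real_asymp
    then have "eventually (\<lambda>t. q T + \<kappa> / 2 * (t - T) \<ge> 0) at_top" by (auto simp: filterlim_at_top)
    then have "eventually (\<lambda>t::real. False) at_top"
      using eventually_ge_at_top[of T]
    proof eventually_elim
      case (elim t)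
      then have "q t \<ge> 0" using q'[of t] by simp
      moreover have "q t < 0" using T(1)[of t] elim by (simp add: q_def)
      ultimately show ?case by simp
    qed
    then show False by simp
  next
    case 2
    then have "eventually (\<lambda>t. p t \<le> 0) at_top" by (auto simp: filterlim_at_bot)
    from eventually_conj[OF this ev] obtain T where T: "\<And>t. t \<ge> T \<Longrightarrow> p t \<le> 0"
        "\<And>t. t \<ge> T \<Longrightarrow> p' t \<ge> \<kappa> * p t * (p t - 2)"
      by (auto simp: eventually_at_top_linorder)
    have "p' t \<ge> 0" if "t \<ge> T" for t
    proof -
      have "\<kappa> * p t * (p t - 2) \<ge> 0"
        using \<kappa> T(1)[OF that] by (intro mult_nonpos_nonpos) (auto simp: mult_le_0_iff)
      then show ?thesis using T(2)[OF that] by simp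
    qed
    then have mono: "p t \<ge> p T" if "t \<ge> T" for t
      using deriv_ge_imp_linear_growth[OF der, of T 0 t] that by auto
    have "eventually (\<lambda>t. p t \<le> p T - 1) at_top" using 2 by (auto simp: filterlim_at_bot)
    then have "eventually (\<lambda>t::real. False) at_top"
      using eventually_ge_at_top[of T] by eventually_elim (use mono in force)
    then show False by simp
  qed
qed

lemma chain_limit_le_two:
  fixes p :: "real \<Rightarrow> real" and xs :: "(real \<times> real) list"
  defines "L \<equiv> lin_prod xs"
  assumes ok: "factors_ok xs" and p: "tame p" and \<kappa>: "\<kappa> > 0" and c: "coeff L 0 > 0"
    and ev: "eventually (\<lambda>t. deriv p t \<ge> \<kappa> * p t * (p t - 2)) at_top"
    and top: "(dop L p \<longlongrightarrow> A) at_top"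
  shows "bounded (range p)" "A \<le> 2 * coeff L 0"
proof -
  note der = tame_DERIV[OF p]
  have nd: "\<not> diverges p" by (rule riccati_not_diverges[OF der \<kappa> ev])
  have "bounded (range (dop L p))"
  proof -
    have "eventually (\<lambda>t. dist (dop L p t) A < 1) at_top" using top by (rule tendstoD) simp
    then obtain T where T: "\<And>t. t \<ge> T \<Longrightarrow> dist (dop L p t) A < 1" by (auto simp: eventually_at_top_linorder)
    then have "dop L p ` {T..} \<subseteq> ball A 1" by (auto simp: dist_commute)
    then have "bounded (dop L p ` {T..})" by (rule bounded_subset[OF bounded_ball])
    moreover have "bounded (dop L p ` {..T})" by (rule tame_bounded[OF tame_dop[OF p]])
    moreover have "{..T} \<union> {T..} = UNIV" by auto
    ultimately show ?thesis by (metis bounded_Un image_Un)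
  qed
  then have cb: "chain_bounded xs p" using chain_boundedI[OF ok p nd] by (simp add: L_def)
  then show bp: "bounded (range p)" by (rule chain_bounded_imp_bounded)
  define l where "l = A / coeff L 0"
  have lim: "(p \<longlongrightarrow> l) at_top"
    using chain_tendsto[OF ok p cb] top by (simp add: L_def l_def)
  have "l \<le> 2"
  proof (rule ccontr)
    assume "\<not> l \<le> 2"
    then have l: "l > 2" by simp
    \<comment> \<open>Half of the limit of the right-hand side, positive because l > 2: eventually
      the derivative of p exceeds it, so p would diverge.\<close>
    define \<delta> where "\<delta> = \<kappa> * l * (l - 2) / 2"
    have \<delta>: "0 < \<delta>" "\<delta> < \<kappa> * l * (l - 2)" using \<kappa> l by (simp_all add: \<delta>_def)
    have "((\<lambda>t. \<kappa> * p t * (p t - 2)) \<longlongrightarrow> \<kappa> * l * (l - 2)) at_top"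
      by (intro tendsto_intros lim)
    then have "eventually (\<lambda>t. \<kappa> * p t * (p t - 2) > \<delta>) at_top"
      using \<delta>(2) by (rule order_tendstoD)
    from eventually_conj[OF this ev] obtain T where "\<And>t. t \<ge> T \<Longrightarrow> deriv p t \<ge> \<delta>"
      by (auto simp: eventually_at_top_linorder intro: less_imp_le less_le_trans)
    then have ge: "p t \<ge> p T + \<delta> * (t - T)" if "t \<ge> T" for t
      using deriv_ge_imp_linear_growth[OF der] that by blast
    have "filterlim (\<lambda>t. p T + \<delta> * (t - T)) at_top at_top" using \<delta>(1) by real_asymp
    then have "filterlim p at_top at_top"
      by (rule filterlim_at_top_mono) (use ge in \<open>auto simp: eventually_at_top_linorder\<close>)
    then show False using nd by (simp add: diverges_def)
  qed
  then show "A \<le> 2 * coeff L 0" using c by (simp add: l_def pos_divide_le_eq)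
qed

section \<open>Iterated Laplacians of radial functions\<close>

lemma neg_laplacian_iter:
  assumes "smooth u" "radially_symmetric u"
  shows "smooth ((neg_laplacian ^^ k) u)" "radially_symmetric ((neg_laplacian ^^ k) u)"
proof -
  have "smooth ((neg_laplacian ^^ k) u) \<and> radially_symmetric ((neg_laplacian ^^ k) u)"
    by (induction k) (auto simp: assms smooth_neg_laplacian radially_symmetric_neg_laplacian)
  then show "smooth ((neg_laplacian ^^ k) u)" "radially_symmetric ((neg_laplacian ^^ k) u)" by auto
qed

text \<open>In the variable ln r the Laplacian is exp (-2 t) D (D + n - 2), and moving the weight exp (2 k t)
  through an operator shifts D to D - 2 k.\<close>

lemma dop_weighted_ray:
  fixes g :: "real ^ 'n::finite \<Rightarrow> real"
  assumes g: "smooth g" "radially_symmetric g"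
  shows "dop ([:2 * real k, -1:] * [:real CARD('n) - 2 - 2 * real k, 1:]) (\<lambda>t. exp (real (2 * k) * t) * ray g t) t
    = exp (real (2 * Suc k) * t) * ray (neg_laplacian g) t"
proof -
  let ?G = "ray g"
  define h where "h = (\<lambda>t. exp (real (2 * k) * t) * ray g t)"
  have tG: "tame ?G" by (rule ray_span_tame[OF ray_span_ray(1)[OF g(1)]])
  note DG = tame_DERIV[OF tG] tame_DERIV[OF tame_deriv[OF tG]]
  have h1: "deriv h = (\<lambda>t. exp (real (2 * k) * t) * (2 * real k * ?G t + deriv ?G t))"
    unfolding h_def by (rule deriv_eqI) (auto intro!: derivative_eq_intros DG simp: algebra_simps)
  have h2: "deriv (deriv h) = (\<lambda>t. exp (real (2 * k) * t) *
      (2 * real k * (2 * real k * ?G t + deriv ?G t) + (2 * real k * deriv ?G t + deriv (deriv ?G) t)))"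
    unfolding h1 by (rule deriv_eqI) (auto intro!: derivative_eq_intros DG simp: algebra_simps)
  let ?b = "real CARD('n) - 2 - 2 * real k"
  have "[:2 * real k, -1:] * [:?b, 1:] = [:2 * real k * ?b, 2 * real k - ?b, -1:]" by simp
  then have "dop ([:2 * real k, -1:] * [:?b, 1:]) h t
      = 2 * real k * ?b * h t + (2 * real k - ?b) * deriv h t - deriv (deriv h) t"
    by (simp add: dop_pCons)
  also have "\<dots> = exp (real (2 * k) * t) * (- (deriv (deriv ?G) t + (real CARD('n) - 2) * deriv ?G t))"
    unfolding h2 unfolding h1 unfolding h_def by (simp add: algebra_simps)
  also have "\<dots> = exp (real (2 * Suc k) * t) * ray (neg_laplacian g) t"
    unfolding ray_neg_laplacian[OF g, symmetric]
    by (simp add: algebra_simps exp_add)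
  finally show ?thesis unfolding h_def .
qed

text \<open>The weight exp (2 k t) left over by k Laplacians is absorbed in the shift of the k-th
  pair of factors, so all coefficients stay constant.\<close>

lemma dop_iter:
  fixes u :: "real ^ 'n::finite \<Rightarrow> real"
  assumes u: "smooth u" "radially_symmetric u"
  shows "dop (\<Prod>k<j. [:2 * real k, -1:] * [:real CARD('n) - 2 - 2 * real k, 1:]) (ray u)
    = (\<lambda>t. exp (real (2 * j) * t) * ray ((neg_laplacian ^^ j) u) t)"
proof (induction j)
  case (Suc j)
  have tu: "tame (ray u)" by (rule ray_span_tame[OF ray_span_ray(1)[OF u(1)]])
  show ?case
    by (rule ext) (simp only: prod.lessThan_Suc mult.commute[of "prod _ _"] dop_mult[OF tu] Suc
      dop_weighted_ray[OF neg_laplacian_iter[OF u]] funpow.simps o_apply)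
qed simp

text \<open>For n = 2 m the factors n - 2 - 2 k + D are the factors 2 k + D in reverse order. Paired
  with 2 k - D they give 4 k^2 - D^2, and k = 0 contributes - D^2.\<close>

lemma prod_factors_eq:
  assumes "m \<ge> 1"
  shows "(\<Prod>k<m. [:2 * real k, -1:] * [:real (2 * m) - 2 - 2 * real k, 1:])
    = lin_prod (gjms_factors m) * [:0, 1:] * [:0, -1:]"
proof -
  obtain j where m: "m = Suc j" using assms by (cases m) auto
  have "(\<Prod>k<m. [:real (2 * m) - 2 - 2 * real k, 1:]) = (\<Prod>k<m. [:2 * real (m - Suc k), 1:])"
    by (rule prod.cong) (auto simp: of_nat_diff algebra_simps)
  also have "\<dots> = (\<Prod>k<m. [:2 * real k, 1:])"
    by (rule prod.nat_diff_reindex[where g = "\<lambda>k. [:2 * real k, 1:]"])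
  finally have 1: "(\<Prod>k<m. [:real (2 * m) - 2 - 2 * real k, 1:]) = (\<Prod>k<m. [:2 * real k, 1:])" .
  have 2: "lin_prod (gjms_factors (Suc i)) * [:0, 1:] * [:0, -1:] = (\<Prod>k<Suc i. [:2 * real k, -1:] * [:2 * real k, 1:])" for i
  proof (induction i)
    case 0
    then show ?case by (simp add: gjms_factors_def lin_prod_def)
  next
    case (Suc i)
    have "lin_prod (gjms_factors (Suc (Suc i))) * [:0, 1:] * [:0, -1:]
        = lin_prod (gjms_factors (Suc i)) * [:0, 1:] * [:0, -1:] * [:4 * (real (Suc i))\<^sup>2, 0, -1:]"
      by (subst lin_prod_gjms_Suc) (simp_all add: mult_ac)
    also have "[:4 * (real (Suc i))\<^sup>2, 0, -1:] = [:2 * real (Suc i), -1:] * [:2 * real (Suc i), 1:]"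
      by (simp add: power2_eq_square algebra_simps)
    finally show ?case using Suc by (simp only: prod.lessThan_Suc)
  qed
  show ?thesis unfolding prod.distrib 1 unfolding m 2 prod.distrib ..
qed

text \<open>Of the two factors belonging to k = 0, - D turns \<open>ray u\<close> into p, and D,
  commuted past L, becomes the outer derivative.\<close>

lemma radial_gjms:
  fixes u :: "real ^ 'n::finite \<Rightarrow> real"
  assumes u: "smooth u" "radially_symmetric u" and m: "CARD('n) = 2 * m" "m \<ge> 1"
  defines "p \<equiv> \<lambda>t. - deriv (ray u) t"
  shows "ray_span 1 TYPE('n) p"
    and "deriv (dop (lin_prod (gjms_factors m)) p) t = exp (real (2 * m) * t) * ray ((neg_laplacian ^^ m) u) t"
proof -
  have tu: "tame (ray u)" by (rule ray_span_tame[OF ray_span_ray(1)[OF u(1)]])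
  show sp: "ray_span 1 TYPE('n) p"
    using ray_span_scale[OF ray_span_ray(2)[OF u(1)], of "-1"] by (simp add: p_def)
  then have tp: "tame p" by (rule ray_span_tame)
  let ?L = "lin_prod (gjms_factors m)"
  have "exp (real (2 * m) * t) * ray ((neg_laplacian ^^ m) u) t = dop (?L * [:0, 1:] * [:0, -1:]) (ray u) t"
    using fun_cong[OF dop_iter[OF u, of m], of t] prod_factors_eq[OF m(2)] by (simp add: m(1))
  also have "\<dots> = dop ?L (dop [:0, 1:] (dop [:0, -1:] (ray u))) t"
    by (simp only: dop_mult tu tame_dop)
  also have "dop [:0, -1:] (ray u) = p" by (simp add: dop_linear p_def)
  also have "dop [:0, 1:] p = deriv p" by (simp add: dop_linear)
  finally show "deriv (dop ?L p) t = exp (real (2 * m) * t) * ray ((neg_laplacian ^^ m) u) t"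
    by (simp add: deriv_dop[OF tp])
qed

section \<open>The volume bound and rigidity\<close>

text \<open>By cosh (ln r - ln l) = (l^2 + r^2) / (2 l r), dilating the bubble by l is translating
  the round profile by ln l.\<close>

lemma bubble_log_coordinate:
  fixes r l :: real
  assumes "r > 0" "l > 0"
  shows "ln r + ln (2 * l / (l\<^sup>2 + r\<^sup>2)) = - ln (cosh (ln r + - ln l))"
proof -
  have pos: "l\<^sup>2 + r\<^sup>2 > 0" using assms by (simp add: add_pos_pos)
  have "cosh (ln r + - ln l) = (r / l + l / r) / 2"
    using assms by (simp add: cosh_field_def exp_diff)
  also have "\<dots> = (l\<^sup>2 + r\<^sup>2) / (2 * l * r)"
    using assms by (simp add: power2_eq_square add_divide_distrib)
  finally have c: "cosh (ln r + - ln l) = (l\<^sup>2 + r\<^sup>2) / (2 * l * r)" .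
  have "ln ((l\<^sup>2 + r\<^sup>2) / (2 * l * r)) = ln (l\<^sup>2 + r\<^sup>2) - (ln (2 * l) + ln r)"
    using assms pos by (subst ln_divide_pos) (simp_all add: ln_mult_pos)
  moreover have "ln (2 * l / (l\<^sup>2 + r\<^sup>2)) = ln (2 * l) - ln (l\<^sup>2 + r\<^sup>2)"
    using assms pos by (subst ln_divide_pos) simp_all
  ultimately show ?thesis unfolding c by simp
qed

lemma continuous_AE_eq_zero:
  fixes h :: "real ^ 'n::finite \<Rightarrow> real"
  assumes "continuous_on UNIV h" "AE x in lebesgue. h x = 0"
  shows "h x = 0"
proof (rule ccontr)
  assume "h x \<noteq> 0"
  let ?S = "{x. h x \<noteq> 0}"
  have op: "open ?S" by (intro open_Collect_neq assms continuous_on_const)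
  have "?S \<in> sets lborel" using borel_open[OF op] by simp
  then have "{x \<in> space lebesgue. h x \<noteq> 0} \<in> sets lebesgue" by simp
  from AE_iff_null[OF this] have "?S \<in> null_sets lebesgue" using assms(2) by simp
  then have "negligible ?S" by (simp add: negligible_iff_null_sets)
  then show False using open_not_negligible[OF op] \<open>h x \<noteq> 0\<close> by blast
qed

lemma continuous_eq_off_zero:
  fixes f g :: "real ^ 'n::finite \<Rightarrow> real"
  assumes "continuous_on UNIV f" "continuous_on UNIV g" "\<And>x. x \<noteq> 0 \<Longrightarrow> f x = g x"
  shows "f x = g x"
proof -
  have "continuous_on (closure (- {0})) (\<lambda>x. f x - g x)"
    by (intro continuous_on_diff) (use assms(1,2) continuous_on_subset in blast)+
  moreover have "x \<in> closure (- {0})" by (simp add: closure_complement)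
  ultimately have "f x - g x = 0"
    using continuous_constant_on_closure[of "- {0}" "\<lambda>x. f x - g x" 0 x] assms(3) by simp
  then show ?thesis by simp
qed

text \<open>With v = \<open>ray u\<close> and positive factors removed, the curvature condition
  reads - (v'' + (n - 2) v') - (n - 2) / 2 (v')^2 \<ge> 0 at t = ln |x|; substituting v' = - p gives
  the claim.\<close>

lemma riccati_of_scalar_curvature:
  fixes u :: "real ^ 'n::finite \<Rightarrow> real"
  assumes u: "smooth u" "radially_symmetric u" and n: "CARD('n) \<ge> 2" and K: "compact K"
    and R: "\<And>x. x \<notin> K \<Longrightarrow> scalar_curvature u x \<ge> 0"
  defines "p \<equiv> \<lambda>t. - deriv (ray u) t"
  shows "eventually (\<lambda>t. deriv p t \<ge> (real CARD('n) - 2) / 2 * p t * (p t - 2)) at_top"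
proof -
  obtain B where B: "B > 0" "\<And>x. x \<in> K \<Longrightarrow> norm x \<le> B"
    using compact_imp_bounded[OF K] by (auto simp: bounded_pos)
  have tu: "tame (ray u)" by (rule ray_span_tame[OF ray_span_ray(1)[OF u(1)]])
  have dp: "deriv p t = - deriv (deriv (ray u)) t" for t
    unfolding p_def using DERIV_minus[OF tame_DERIV[OF tame_deriv[OF tu]]] by (intro DERIV_imp_deriv)
  have clear_denom: "0 \<le> - X - k * Y" if "0 \<le> - (X / E) - k * (Y / E)" "E > 0" for X Y E k :: real
  proof -
    have "- (X / E) - k * (Y / E) = (- X - k * Y) / E" by (simp add: diff_divide_distrib)
    then show ?thesis using that by (simp add: zero_le_divide_iff)
  qed
  show ?thesis
    using eventually_gt_at_top[of "ln B"]
  proof eventually_elim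
    case (elim t)
    define x :: "real ^ 'n" where "x = exp t *\<^sub>R axis undefined 1"
    have nx: "norm x = exp t" "x \<noteq> 0" by (simp_all add: x_def norm_axis_1)
    have pos: "2 * (real CARD('n) - 1) * exp (- 2 * u x) > 0" using n by simp
    have "exp t > B" using elim B(1) by (metis exp_less_cancel_iff exp_ln)
    then have "scalar_curvature u x \<ge> 0" using B(2)[of x] nx by (intro R) auto
    then have "- laplacian u x - (real CARD('n) - 2) / 2 * (norm (grad u x))\<^sup>2 \<ge> 0"
      unfolding scalar_curvature_def using mult_le_cancel_left_pos[OF pos, of 0] by (simp only: mult_zero_right)
    then have "- ((deriv (deriv (ray u)) t + (real CARD('n) - 2) * deriv (ray u) t) / (exp t)\<^sup>2)
        - (real CARD('n) - 2) / 2 * ((deriv (ray u) t)\<^sup>2 / (exp t)\<^sup>2) \<ge> 0"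
      by (simp only: laplacian_radial[OF u nx(2)] grad_radial[OF u nx(2)] nx ln_exp)
    then have "- (deriv (deriv (ray u)) t + (real CARD('n) - 2) * deriv (ray u) t)
        - (real CARD('n) - 2) / 2 * (deriv (ray u) t)\<^sup>2 \<ge> 0"
      by (rule clear_denom) simp
    moreover have "(real CARD('n) - 2) / 2 * p t * (p t - 2)
        = (real CARD('n) - 2) / 2 * (deriv (ray u) t)\<^sup>2 + (real CARD('n) - 2) * deriv (ray u) t"
      by (simp add: p_def algebra_simps power2_eq_square add_divide_distrib diff_divide_distrib)
    ultimately show ?case unfolding dp by linarith
  qed
qed

text \<open>The translated round P, divided by (n - 1)!, is a primitive of the radial volume
  density. Its limits do not depend on the dilation l.\<close>

lemma bubble_volume:
  fixes u :: "real ^ 'n::finite \<Rightarrow> real"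
  assumes cont: "continuous_on UNIV u" and l: "l > 0" and m: "CARD('n) = 2 * m" "m \<ge> 1"
    and u: "\<And>x. u x = ln (2 * l / (l\<^sup>2 + (norm x)\<^sup>2))"
  shows "(LINT x|lebesgue. exp (real CARD('n) * u x)) = sphere_volume TYPE('n)"
proof -
  let ?L = "lin_prod (gjms_factors m)"
  let ?N = "real CARD('n)"
  define P where "P = dop ?L (\<lambda>t. 1 + tanh t)"
  note sp = sphere_profile[OF m(2), folded P_def]
  have tP: "tame P" unfolding P_def by (rule tame_dop[OF sp(1)])
  define F where "F = (\<lambda>t. exp (?N * (- ln (cosh (t + - ln l)))))"
  define g where "g = (\<lambda>t. exp (?N * ln (2 * l / (l\<^sup>2 + (exp t)\<^sup>2))))"
  have "(LINT x|lebesgue. exp (?N * u x)) = ?N * unit_ball_vol ?N * (\<integral>t. exp (?N * t) * g t \<partial>lborel)"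
  proof (rule radial_lebesgue_integral(2))
    show "(\<lambda>x. exp (?N * u x)) \<in> borel_measurable borel"
      by (intro borel_measurable_continuous_onI continuous_intros cont)
    show "g \<in> borel_measurable borel" unfolding g_def by measurable
    show "exp (?N * u x) = g (ln (norm x))" if "x \<noteq> 0" for x
      using that by (simp add: g_def u)
  qed
  also have "(\<lambda>t. exp (?N * t) * g t) = F"
  proof
    fix t
    have "exp (?N * t) * g t = exp (?N * (ln (exp t) + ln (2 * l / (l\<^sup>2 + (exp t)\<^sup>2))))"
      by (simp add: g_def distrib_left exp_add)
    also have "\<dots> = F t" unfolding F_def by (subst bubble_log_coordinate[OF exp_gt_zero l]) simp
    finally show "exp (?N * t) * g t = F t" .
  qed
  also have "integral\<^sup>L lborel F = 2 * coeff ?L 0 / fact (2 * m - 1) - 0"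
  proof (rule lborel_FTC_nonneg(2)[where P = "\<lambda>t. P (t + - ln l) / fact (2 * m - 1)"])
    have "((\<lambda>t. P (t + - ln l)) has_real_derivative deriv P (t + - ln l)) (at t)" for t
      using tame_DERIV[OF tP, of "t + - ln l"] by (simp only: DERIV_shift)
    from DERIV_cdivide[OF this, of "fact (2 * m - 1)"]
    show "((\<lambda>t. P (t + - ln l) / fact (2 * m - 1)) has_real_derivative F t) (at t)" for t
      by (simp add: sp(4) F_def m(1))
    have "((\<lambda>t. P (t + - ln l)) \<longlongrightarrow> 0) at_bot"
      by (rule filterlim_compose[OF sp(2)]) real_asymp
    from tendsto_divide[OF this tendsto_const, of "fact (2 * m - 1)"]
    show "((\<lambda>t. P (t + - ln l) / fact (2 * m - 1)) \<longlongrightarrow> 0) at_bot" by simp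
    have "((\<lambda>t. P (t + - ln l)) \<longlongrightarrow> 2 * coeff ?L 0) at_top"
      by (rule filterlim_compose[OF sp(3)]) real_asymp
    then show "((\<lambda>t. P (t + - ln l) / fact (2 * m - 1)) \<longlongrightarrow> 2 * coeff ?L 0 / fact (2 * m - 1)) at_top"
      by (rule tendsto_divide) auto
    show "isCont F t" for t
      unfolding F_def using cosh_real_pos by (intro continuous_intros) (simp add: less_imp_neq[symmetric])+
  qed (simp add: F_def)
  finally show ?thesis
    by (simp add: sphere_volume_even[OF m] m(1) coeff_gjms_0[OF m(2)])
qed

theorem theorem1p4:
  fixes u :: "real ^ 'n::finite \<Rightarrow> real"
  assumes "CARD('n) \<ge> 4" and "even CARD('n)"
    and "smooth u" and "radially_symmetric u"
    and "integrable lebesgue (\<lambda>x. Q_curvature u x * exp (real CARD('n) * u x))"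
    and "\<forall>x. Q_curvature u x \<ge> fact (CARD('n) - 1)"
    and "\<exists>K. compact K \<and> (\<forall>x. x \<notin> K \<longrightarrow> scalar_curvature u x \<ge> 0)"
  shows "integrable lebesgue (\<lambda>x. exp (real CARD('n) * u x)) \<and>
    (LINT x|lebesgue. exp (real CARD('n) * u x)) \<le> sphere_volume TYPE('n) \<and>
    ((LINT x|lebesgue. exp (real CARD('n) * u x)) = sphere_volume TYPE('n) \<longleftrightarrow>
      (\<exists>l>0. \<forall>x. u x = ln (2 * l / (l\<^sup>2 + (norm x)\<^sup>2))))"
proof -
  note u = \<open>smooth u\<close> \<open>radially_symmetric u\<close>
  obtain m where n: "CARD('n) = 2 * m" using \<open>even CARD('n)\<close> by blast
  with assms(1) have m: "m \<ge> 1" "m \<ge> 2" by auto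
  let ?N = "real (2 * m)" and ?q = "fact (2 * m - 1) :: real"
  let ?vol = "LINT x|lebesgue. exp (?N * u x)"
  define f where "f = (neg_laplacian ^^ m) u"
  define v where "v = ray u"
  define p where "p = (\<lambda>t. - deriv v t)"
  define L where "L = lin_prod (gjms_factors m)"
  define P where "P = dop L p"
  define F where "F = (\<lambda>t. exp (?N * t) * ray f t)"
  define c where "c = coeff L 0"
  have c: "c > 0" by (simp add: c_def L_def coeff_gjms_0[OF m(1)])
  have f: "smooth f" "radially_symmetric f"
    unfolding f_def by (rule neg_laplacian_iter[OF u])+
  have f_eq: "f x = Q_curvature u x * exp (?N * u x)" for x
    using Q_curvature_eq[of u x] by (simp add: f_def n)
  have f_ge: "f x \<ge> ?q * exp (?N * u x)" for x
    using assms(6) unfolding f_eq by (intro mult_right_mono) (auto simp: n)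
  have cont_u: "continuous_on UNIV u" and cont_f: "continuous_on UNIV f"
    by (rule smooth_continuous, fact)+
  have tu: "tame v" unfolding v_def by (rule ray_span_tame[OF ray_span_ray(1)[OF u(1)]])
  have tf: "tame (ray f)" by (rule ray_span_tame[OF ray_span_ray(1)[OF f(1)]])
  have sp: "ray_span 1 TYPE('n) p" and dP: "deriv P t = F t" for t
    unfolding P_def p_def v_def L_def F_def f_def using radial_gjms[OF u n m(1)] by simp_all
  have tp: "tame p" by (rule ray_span_tame[OF sp])
  have tP: "tame P" unfolding P_def by (rule tame_dop[OF tp])
  have DP: "(P has_real_derivative F t) (at t)" for t
    using tame_DERIV[OF tP] dP by simp
  have F_pos: "F t > 0" for t
  proof -
    have "0 < ?q * exp (?N * u (exp t *\<^sub>R axis undefined 1))" by simp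
    also have "\<dots> \<le> ray f t" unfolding ray_def by (rule f_ge)
    finally show ?thesis by (simp add: F_def)
  qed
  have cont_F: "isCont F t" for t
    using tame_continuous[OF tame_deriv[OF tP], of UNIV] dP
    by (simp add: continuous_on_eq_continuous_at fun_eq_iff[symmetric])
  have P_bot: "(P \<longlongrightarrow> 0) at_bot"
    using ray_span_at_bot[OF ray_span_dop[OF sp]] by (auto simp: P_def)

  have rad: "integrable lebesgue f \<longleftrightarrow> integrable lborel F"
    "integral\<^sup>L lebesgue f = ?N * unit_ball_vol ?N * integral\<^sup>L lborel F"
    using radial_lebesgue_integral[of f "ray f"] radial_eq_ray[OF f(2)]
      borel_measurable_continuous_onI[OF cont_f] borel_measurable_continuous_onI[OF tame_continuous[OF tf]]
    unfolding F_def by (simp_all add: n)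
  have int_f: "integrable lebesgue f"
    using assms(5) by (simp add: f_eq[abs_def] n)
  then have int_F: "integrable lborel F" using rad by simp
  obtain A where A: "(P \<longlongrightarrow> A) at_top"
    using primitive_tendsto_at_top[OF DP cont_F less_imp_le[OF F_pos] int_F] by blast
  have lint_F: "integral\<^sup>L lborel F = A"
    using lborel_FTC_nonneg(2)[OF DP cont_F less_imp_le[OF F_pos] P_bot A] by simp
  have lint_f: "integral\<^sup>L lebesgue f = ?N * unit_ball_vol ?N * A"
    using rad lint_F by simp

  obtain K where K: "compact K" "\<And>x. x \<notin> K \<Longrightarrow> scalar_curvature u x \<ge> 0" using assms(7) by blast
  have ev: "eventually (\<lambda>t. deriv p t \<ge> (real CARD('n) - 2) / 2 * p t * (p t - 2)) at_top"
    unfolding p_def v_def by (rule riccati_of_scalar_curvature[OF u _ K]) (use assms(1) in auto)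
  have bp: "bounded (range p)" and A_le: "A \<le> 2 * c"
    using chain_limit_le_two[OF factors_ok_gjms tp _ _ ev, of m A] A c assms(1)
    by (simp_all add: P_def L_def c_def)

  \<comment> \<open>The threshold 2 c for A corresponds to the total Q-curvature (n - 1)! |S^n| of
    the round sphere.\<close>
  have sv: "?N * unit_ball_vol ?N * (2 * c) = ?q * sphere_volume TYPE('n)"
    by (simp add: sphere_volume_even[OF n m(1)] c_def L_def coeff_gjms_0[OF m(1)])
  have w_pos: "?N * unit_ball_vol ?N > 0" using m by simp
  have int_e: "integrable lebesgue (\<lambda>x. exp (?N * u x))"
  proof (rule Bochner_Integration.integrable_bound[OF int_f])
    show "(\<lambda>x. exp (?N * u x)) \<in> borel_measurable lebesgue"
      by (intro measurable_completion) (auto intro!: borel_measurable_continuous_onI continuous_intros cont_u)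
    have "exp (?N * u x) \<le> f x" for x
    proof -
      have "1 * exp (?N * u x) \<le> ?q * exp (?N * u x)" by (intro mult_right_mono fact_ge_1) auto
      from order_trans[OF this f_ge] show ?thesis by simp
    qed
    then show "AE x in lebesgue. norm (exp (?N * u x)) \<le> norm (f x)"
      by (intro AE_I2) (smt (verit, best) exp_gt_zero real_norm_def)
  qed
  have vol_le: "?q * ?vol \<le> integral\<^sup>L lebesgue f"
    using integral_mono[OF integrable_mult_right[OF int_e, of ?q] int_f] f_ge by simp
  have "?q * ?vol \<le> ?q * sphere_volume TYPE('n)"
    using vol_le mult_left_mono[OF A_le, of "?N * unit_ball_vol ?N"] w_pos unfolding lint_f sv by linarith
  then have main: "?vol \<le> sphere_volume TYPE('n)" by simp

  have rigid: "\<exists>l>0. \<forall>x. u x = ln (2 * l / (l\<^sup>2 + (norm x)\<^sup>2))" if eq: "?vol = sphere_volume TYPE('n)"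
  proof -
    \<comment> \<open>Equality of the volumes forces equality in both estimates: A = 2 c, and the
      integrals of f and (n - 1)! exp (n u) coincide, so these ordered continuous functions
      agree.\<close>
    have "?N * unit_ball_vol ?N * (2 * c) \<le> ?N * unit_ball_vol ?N * A"
      using vol_le unfolding lint_f eq sv .
    then have "2 * c \<le> A" by (rule mult_left_le_imp_le[OF _ w_pos])
    then have A_eq: "A = 2 * c" using A_le by simp
    have "integral\<^sup>L lebesgue (\<lambda>x. f x - ?q * exp (?N * u x)) = integral\<^sup>L lebesgue f - ?q * ?vol"
      using int_f int_e by simp
    also have "\<dots> = 0" unfolding lint_f A_eq eq sv by simp
    finally have "integral\<^sup>L lebesgue (\<lambda>x. f x - ?q * exp (?N * u x)) = 0" .
    then have "AE x in lebesgue. f x - ?q * exp (?N * u x) = 0"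
      using f_ge int_f int_e by (subst (asm) integral_nonneg_eq_0_iff_AE) auto
    moreover have "continuous_on UNIV (\<lambda>x. f x - ?q * exp (?N * u x))"
      by (intro continuous_intros cont_u cont_f)
    ultimately have f_const: "f x = ?q * exp (?N * u x)" for x
      using continuous_AE_eq_zero[of "\<lambda>x. f x - ?q * exp (?N * u x)" x] by simp
    define U where "U = (\<lambda>t. t + v t)"
    have F_eq: "F t = ?q * exp (?N * U t)" for t
      by (simp add: F_def ray_def[of f] f_const U_def v_def ray_def[of u] distrib_left exp_add)
    note sphere = sphere_profile[OF m(1), folded L_def]
    obtain ys where xs: "gjms_factors m = (2, 1) # (2, -1) # ys" using gjms_factors_Cons[OF m(2)] by blast
    have P_le: "P t \<le> 2 * c" for t
    proof -
      have "0 \<le> 2 * c - P t"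
      proof (rule nonneg_from_top[where T = t and t = t and h = "\<lambda>t. 2 * c - P t" and h' = "\<lambda>t. 0 - F t"])
        show "((\<lambda>t. 2 * c - P t) \<longlongrightarrow> 0) at_top"
          using tendsto_diff[OF tendsto_const[of "2 * c"] A] by (simp add: A_eq)
        show "((\<lambda>t. 2 * c - P t) has_real_derivative 0 - F t) (at t)" for t
          by (rule DERIV_diff[OF DERIV_const DP])
      qed (auto intro: less_imp_le F_pos)
      then show ?thesis by simp
    qed
    have P_ge: "P t \<ge> 0" for t
      by (rule nonneg_from_bot[OF P_bot DP, where T = t]) (auto intro: less_imp_le F_pos)
    \<comment> \<open>The scalar curvature controls p only near infinity. The bound on the whole
      line comes from L (2 - p) = 2 c - P \<ge> 0 and the positivity of the bounded inverse of
      L.\<close>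
    have p_le: "p t \<le> 2" for t
    proof -
      let ?y = "\<lambda>t. 2 * 1 + (-1) * p t"
      have ty: "tame ?y" by (rule tame_lincomb[OF tame_const tp])
      have dy: "dop L ?y = (\<lambda>t. 2 * c - P t)"
        using dop_lincomb[OF tame_const tp, of L 2 1 "-1"] by (simp add: fun_eq_iff dop_const c_def P_def)
      have "bounded (range ?y)"
        by (intro bounded_image_lincomb bp) (simp add: image_constant_conv)
      moreover have "bounded (range (dop L ?y))"
        unfolding dy bounded_iff using P_le P_ge by (intro exI[of _ "2 * c"]) auto
      ultimately have "chain_bounded (gjms_factors m) ?y"
        by (intro chain_boundedI factors_ok_gjms ty not_diverges) (simp_all add: L_def)
      then have "?y t \<ge> 0"
        by (rule chain_nonneg[OF factors_ok_gjms ty]) (simp only: dy L_def[symmetric], simp add: P_le)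
      then show ?thesis by simp
    qed
    \<comment> \<open>Continuity of u at the origin supplies the left barrier U t \<le> t + u 0 + 1
      of the sliding argument.\<close>
    have "eventually (\<lambda>t. v t < u 0 + 1) at_bot"
      unfolding v_def by (rule order_tendstoD(2)[OF ray_at_bot[OF u(1)]]) simp
    then obtain T0 where T0: "\<And>t. t \<le> T0 \<Longrightarrow> v t < u 0 + 1" by (auto simp: eventually_at_bot_linorder)
    have "\<exists>l. \<forall>t. U t = (\<lambda>t. - ln (cosh t)) (t + l)"
    proof (rule sliding_unique[OF factors_ok_gjms xs tp sphere(1) bp, folded L_def, folded P_def,
          where Tb = T0 and Cb = "u 0 + 1" and B = "ln 2" and M = "2 * c" and \<kappa> = ?q and N = ?N])
      show "bounded (range (\<lambda>t::real. 1 + tanh t))"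
      proof -
        have "\<bar>1 + tanh t\<bar> \<le> 2" for t :: real using tanh_real_bounds[of t] by (simp add: abs_le_iff)
        then show ?thesis unfolding bounded_iff by (intro exI[of _ 2]) auto
      qed
      show "(U has_real_derivative 1 - p t) (at t)" for t
        unfolding U_def p_def using tame_DERIV[OF tu] by (auto intro!: derivative_eq_intros)
      show "((\<lambda>t. - ln (cosh t)) has_real_derivative 1 - (1 + tanh t)) (at t)" for t :: real
        by (rule DERIV_ln_cosh)
      show "deriv P t = ?q * exp (?N * U t)" for t by (simp only: dP F_eq)
      show "U t \<le> t + (u 0 + 1)" if "t \<le> T0" for t using T0[OF that] by (simp add: U_def)
      show "0 \<le> 1 + tanh t" "1 + tanh t \<le> 2" for t :: real
        using tanh_real_bounds[of t] by auto
      show "(dop L (\<lambda>t. 1 + tanh t) \<longlongrightarrow> 2 * c) at_top" using sphere(3) by (simp add: c_def)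
    qed (use m c P_bot A A_eq p_le sphere ln_cosh_bounds in auto)
    then obtain l where l: "\<And>t. U t = - ln (cosh (t + l))" by blast
    \<comment> \<open>A translation by l in t is a bubble with parameter exp (- l). The logarithmic
      coordinate misses the origin, which continuity restores afterwards.\<close>
    have off: "u x = ln (2 * exp (- l) / ((exp (- l))\<^sup>2 + (norm x)\<^sup>2))" if "x \<noteq> 0" for x
    proof -
      have "u x = U (ln (norm x)) - ln (norm x)"
        using radial_eq_ray[OF u(2) that] by (simp add: U_def v_def)
      also have "\<dots> = - ln (cosh (ln (norm x) + - ln (exp (- l)))) - ln (norm x)" by (simp add: l)
      also have "\<dots> = ln (2 * exp (- l) / ((exp (- l))\<^sup>2 + (norm x)\<^sup>2))"
        using bubble_log_coordinate[of "norm x" "exp (- l)"] that by simp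
      finally show ?thesis .
    qed
    have pos: "(exp (- l))\<^sup>2 + (norm x)\<^sup>2 > 0" for x :: "real ^ 'n"
      by (intro add_pos_nonneg) auto
    have "continuous_on UNIV (\<lambda>x::real^'n. ln (2 * exp (- l) / ((exp (- l))\<^sup>2 + (norm x)\<^sup>2)))"
      using pos by (intro continuous_intros) (auto simp: less_imp_neq[symmetric])
    from continuous_eq_off_zero[OF cont_u this off]
    show ?thesis by (intro exI[of _ "exp (- l)"]) auto
  qed
  have bubble: "?vol = sphere_volume TYPE('n)"
    if "\<exists>l>0. \<forall>x. u x = ln (2 * l / (l\<^sup>2 + (norm x)\<^sup>2))"
    using that bubble_volume[OF cont_u _ n m(1)] by (auto simp: n)
  show ?thesis unfolding n using int_e main rigid bubble by blast
qed

end
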